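(* Let $H\in(0,1)$ and let $R^H_t=\int_0^t(t-s)^{H-1/2}\,\mathrm{d}W_s$, $t\in[0,T]$, be the Riemann--Liouville process with parameter $H$. Consider the SDE $$\mathrm{d}X_t=b(t,X_t)\,\mathrm{d}t+\mathrm{d}R^H_t,\quad t\in[0,T],\qquad X_0=x_0\in\mathbb{R},\qquad (\ast)$$ where $b\colon[0,T]\times\mathbb{R}\to\mathbb{R}$ is a measurable function. Then the following assertions hold. (i) If $b(t,x)$ is piecewise uniformly continuous in the variable $x$, with finitely many discontinuity points $a_1,\dots,a_m\in\mathbb{R}$, $m\in\mathbb{N}$, and there is a constant $C$ with $|b(t,x)|\le C(1+|x|)$ for every $x\in\mathbb{R}$, uniformly in $t\in[0,T]$, then there exists a strong solution to $(\ast)$. Moreover, if $b(t,x)$ is in addition non-increasing in $x$ for every $t$, the solution is unique. (ii) If there exist $m\in\mathbb{N}$, countable sets $M_1,\dots,M_m\subset\mathbb{R}$ and functions $f_1,\dots,f_m$ with $f_i\in L^{q_i}(\mathbb{R})$, $q_1,\dots,q_m\in(1,\infty]$, such that $b(t,x)=b(x)=\sum_{i=1}^m f_i(x)\mathbf{1}_{M_i}(x)$ for $x\in\mathbb{R}$, then there exists a strong solution to $(\ast)$. Moreover, if the functions $f_i$ are bounded, the solution is unique. (iii) Let $M\subset\mathbb{R}$ be a set such that $\mathbb{R}\setminus M$ is countable. If $b(x)=\mathbf{1}_M(x)$, $x\in\mathbb{R}$, then $(\ast)$ admits a unique strong solution. More generally, if $b(t,x)=\tilde b(t,x)\mathbf{1}_M(x)$,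 where $\tilde b$ is a measurable, uniformly bounded function such that $(\ast)$ with $b$ replaced by $\tilde b$ admits a unique strong solution, then $(\ast)$ with $b$ also admits a unique strong solution.
   Context: $T\in(0,\infty)$ is fixed, $(\Omega,(\mathcal{A}_t)_{t\in[0,T]},\mathbb{P})$ is a filtered probability space, $W$ is a standard one-dimensional Brownian motion on it, and $(\mathcal{A}_t)$ is the augmented filtration generated by $W$, satisfying the usual conditions. A strong solution is an $(\mathcal{A}_t)$-adapted process $X$ on the given space with $X_t=x_0+\int_0^t b(s,X_s)\,\mathrm{d}s+R^H_t$, $t\in[0,T]$, almost surely; uniqueness means that any two ($(\mathcal{A}_t)$-adapted) solutions coincide for every $t\in[0,T]$ almost surely. Piecewise uniformly continuous in $x$ with discontinuity points $a_1<\dots<a_m$ means uniformly continuous in $x$ on each of the open intervals $(-\infty,a_1),(a_1,a_2),\dots,(a_m,\infty)$. The $f_i$ are pointwise defined measurable functions. *)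

theory Defs
  imports "HOL-Probability.Probability"
begin

text \<open>
  The natural filtration of \<open>W\<close>, augmented by all null sets of \<open>M\<close>. For a Brownian motion on a
  complete probability space this filtration is automatically right-continuous (on the
  interval where \<open>W\<close> lives), so that it satisfies the usual conditions.
\<close>

definition augmented_filtration :: "'a measure \<Rightarrow> (real \<Rightarrow> 'a \<Rightarrow> real) \<Rightarrow> real \<Rightarrow> 'a measure" where
  "augmented_filtration M W t =
     sigma (space M)
       ({W s -` B \<inter> space M | s B. s \<in> {0..t} \<and> B \<in> sets borel} \<union> null_sets M)"

lemma augmented_filtration_gen:
  "{W s -` B \<inter> space M | s B. s \<in> {0..t} \<and> B \<in> sets borel} \<union> null_sets M \<subseteq> Pow (space M)"
  using sets.sets_into_space by (auto simp: null_sets_def)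

lemma filtration_augmented_filtration:
  "filtration (space M) (augmented_filtration M W)"
proof
  show "space (augmented_filtration M W i) = space M" for i
    unfolding augmented_filtration_def
    by (rule space_measure_of[OF augmented_filtration_gen])
  show "sets (augmented_filtration M W i) \<le> sets (augmented_filtration M W j)" if "i \<le> j" for i j
    unfolding augmented_filtration_def sets_measure_of[OF augmented_filtration_gen]
    using that by (intro sigma_sets_mono' Un_mono) (force, blast)
qed

text \<open>Only the restriction of \<open>W\<close> to \<open>[0, T]\<close> matters; \<open>normal_density\<close> takes the standard
  deviation.\<close>

definition standard_brownian_motion :: "'a measure \<Rightarrow> real \<Rightarrow> (real \<Rightarrow> 'a \<Rightarrow> real) \<Rightarrow> bool" where
  "standard_brownian_motion M T W \<longleftrightarrow>
     (\<forall>t\<in>{0..T}. W t \<in> borel_measurable M) \<and>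
     (AE \<omega> in M. W 0 \<omega> = 0) \<and>
     (AE \<omega> in M. continuous_on {0..T} (\<lambda>t. W t \<omega>)) \<and>
     (\<forall>s t. 0 \<le> s \<and> s < t \<and> t \<le> T \<longrightarrow>
        distributed M lborel (\<lambda>\<omega>. W t \<omega> - W s \<omega>) (normal_density 0 (sqrt (t - s))) \<and>
        prob_space.indep_set M
          (sets (augmented_filtration M W s))
          (sets (vimage_algebra (space M) (\<lambda>\<omega>. W t \<omega> - W s \<omega>) borel)))"

text \<open>
  The step function with value \<open>c i\<close> on \<open>(p i, p (i + 1)]\<close> for \<open>i < n\<close>, and its elementary
  integral against \<open>W\<close>.
\<close>

definition step_fun :: "nat \<Rightarrow> (nat \<Rightarrow> real) \<Rightarrow> (nat \<Rightarrow> real) \<Rightarrow> real \<Rightarrow> real" where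
  "step_fun n c p s = (\<Sum>i<n. c i * indicator {p i<..p (Suc i)} s)"

definition step_integral ::
    "(real \<Rightarrow> 'a \<Rightarrow> real) \<Rightarrow> nat \<Rightarrow> (nat \<Rightarrow> real) \<Rightarrow> (nat \<Rightarrow> real) \<Rightarrow> 'a \<Rightarrow> real" where
  "step_integral W n c p \<omega> = (\<Sum>i<n. c i * (W (p (Suc i)) \<omega> - W (p i) \<omega>))"

text \<open>
  \<open>I\<close> is a version of the Wiener integral of the deterministic function \<open>f\<close> over \<open>[0, t]\<close>: the
  limit in \<open>L\<^sup>2\<close> of \<open>M\<close> of the elementary integrals of step functions that converge to \<open>f\<close> in
  \<open>L\<^sup>2\<close> of \<open>[0, t]\<close>. By the Ito isometry, \<open>I\<close> is determined almost surely.
\<close>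

definition has_wiener_integral ::
    "'a measure \<Rightarrow> (real \<Rightarrow> 'a \<Rightarrow> real) \<Rightarrow> (real \<Rightarrow> real) \<Rightarrow> real \<Rightarrow> ('a \<Rightarrow> real) \<Rightarrow> bool" where
  "has_wiener_integral M W f t I \<longleftrightarrow>
     set_borel_measurable lborel {0..t} f \<and> I \<in> borel_measurable M \<and>
     (\<exists>n c p.
        (\<forall>k. mono_on {..n k} (p k) \<and> 0 \<le> p k 0 \<and> p k (n k) \<le> t) \<and>
        (\<lambda>k. \<integral>\<^sup>+ s\<in>{0..t}. ennreal ((f s - step_fun (n k) (c k) (p k) s)\<^sup>2) \<partial>lborel)
           \<longlonglongrightarrow> 0 \<and>
        (\<lambda>k. \<integral>\<^sup>+ \<omega>. ennreal ((I \<omega> - step_integral W (n k) (c k) (p k) \<omega>)\<^sup>2) \<partial>M)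
           \<longlonglongrightarrow> 0)"

text \<open>
  The Wiener integrals fix the process only up to modification; as usual the (up to
  indistinguishability unique) modification with continuous paths is meant. The integrand at
  \<open>s = t\<close>, where \<open>0 powr a = 0\<close>, is irrelevant.
\<close>

definition riemann_liouville_process ::
    "'a measure \<Rightarrow> real \<Rightarrow> (real \<Rightarrow> 'a \<Rightarrow> real) \<Rightarrow> real \<Rightarrow> (real \<Rightarrow> 'a \<Rightarrow> real) \<Rightarrow> bool" where
  "riemann_liouville_process M T W H R \<longleftrightarrow>
     (\<forall>t\<in>{0..T}. has_wiener_integral M W (\<lambda>s. (t - s) powr (H - 1 / 2)) t (R t)) \<and>
     (AE \<omega> in M. continuous_on {0..T} (\<lambda>t. R t \<omega>))"

definition drift_measurable :: "real \<Rightarrow> (real \<Rightarrow> real \<Rightarrow> real) \<Rightarrow> bool" where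
  "drift_measurable T b \<longleftrightarrow>
     (\<lambda>(t, x). b t x) \<in> borel_measurable (restrict_space borel ({0..T} \<times> UNIV))"

text \<open>
  Integrability of the drift along the path is part of the notion, since the Lebesgue integral
  of a non-integrable function is \<open>0\<close> by convention.
\<close>

definition strong_solution ::
    "'a measure \<Rightarrow> real \<Rightarrow> (real \<Rightarrow> 'a \<Rightarrow> real) \<Rightarrow> (real \<Rightarrow> 'a \<Rightarrow> real) \<Rightarrow> real \<Rightarrow>
     (real \<Rightarrow> real \<Rightarrow> real) \<Rightarrow> (real \<Rightarrow> 'a \<Rightarrow> real) \<Rightarrow> bool" where
  "strong_solution M T W R x0 b X \<longleftrightarrow>
     (\<forall>t\<in>{0..T}. X t \<in> borel_measurable (augmented_filtration M W t)) \<and>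
     (AE \<omega> in M. \<forall>t\<in>{0..T}.
        set_integrable lborel {0..t} (\<lambda>s. b s (X s \<omega>)) \<and>
        X t \<omega> = x0 + (LINT s:{0..t}|lborel. b s (X s \<omega>)) + R t \<omega>)"

definition strong_existence ::
    "'a measure \<Rightarrow> real \<Rightarrow> (real \<Rightarrow> 'a \<Rightarrow> real) \<Rightarrow> (real \<Rightarrow> 'a \<Rightarrow> real) \<Rightarrow> real \<Rightarrow>
     (real \<Rightarrow> real \<Rightarrow> real) \<Rightarrow> bool" where
  "strong_existence M T W R x0 b \<longleftrightarrow> (\<exists>X. strong_solution M T W R x0 b X)"

definition strong_uniqueness ::
    "'a measure \<Rightarrow> real \<Rightarrow> (real \<Rightarrow> 'a \<Rightarrow> real) \<Rightarrow> (real \<Rightarrow> 'a \<Rightarrow> real) \<Rightarrow> real \<Rightarrow>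
     (real \<Rightarrow> real \<Rightarrow> real) \<Rightarrow> bool" where
  "strong_uniqueness M T W R x0 b \<longleftrightarrow>
     (\<forall>X Y. strong_solution M T W R x0 b X \<and> strong_solution M T W R x0 b Y \<longrightarrow>
        (AE \<omega> in M. \<forall>t\<in>{0..T}. X t \<omega> = Y t \<omega>))"

definition unique_strong_solution ::
    "'a measure \<Rightarrow> real \<Rightarrow> (real \<Rightarrow> 'a \<Rightarrow> real) \<Rightarrow> (real \<Rightarrow> 'a \<Rightarrow> real) \<Rightarrow> real \<Rightarrow>
     (real \<Rightarrow> real \<Rightarrow> real) \<Rightarrow> bool" where
  "unique_strong_solution M T W R x0 b \<longleftrightarrow>
     strong_existence M T W R x0 b \<and> strong_uniqueness M T W R x0 b"

text \<open>
  The points are \<open>a 1 < \<dots> < a m\<close>. No condition is put on the values of \<open>g\<close> at these points, and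
  they need not be actual discontinuities; hence \<open>m \<ge> 1\<close> is no restriction.
\<close>

definition piecewise_uniformly_continuous :: "nat \<Rightarrow> (nat \<Rightarrow> real) \<Rightarrow> (real \<Rightarrow> real) \<Rightarrow> bool" where
  "piecewise_uniformly_continuous m a g \<longleftrightarrow>
     1 \<le> m \<and> strict_mono_on {1..m} a \<and>
     uniformly_continuous_on {..<a 1} g \<and>
     (\<forall>i\<in>{1..<m}. uniformly_continuous_on {a i<..<a (Suc i)} g) \<and>
     uniformly_continuous_on {a m<..} g"

text \<open>
  Functions, not equivalence classes, are considered; \<open>f\<close> is only required to be Lebesgue
  measurable, which includes the Borel functions.
\<close>

definition in_Lq :: "ereal \<Rightarrow> (real \<Rightarrow> real) \<Rightarrow> bool" where
  "in_Lq q f \<longleftrightarrow>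
     f \<in> borel_measurable lebesgue \<and>
     (if q = \<infinity> then esssup lebesgue (\<lambda>x. ereal \<bar>f x\<bar>) < \<infinity>
      else integrable lebesgue (\<lambda>x. \<bar>f x\<bar> powr real_of_ereal q))"

end

theory Submission
  imports Defs
begin

text \<open>
  Let \<open>X\<close> be any process such that \<open>X - R\<close> has Lipschitz paths, as is the case for solutions with
  bounded drift. On a level set of \<open>X\<close> the increments of \<open>R\<close> are at most \<open>K * \<bar>t - s\<bar>\<close>,
  but \<open>R t - R s\<close> given the past of \<open>s\<close> is Gaussian with a standard deviation of order
  \<open>\<bar>t - s\<bar> powr H\<close>, where \<open>H < 1\<close>. Hence almost surely all level sets of all such \<open>X\<close> are null
  sets, and changing a drift on countably many values of \<open>x\<close> does not affect the equation; no
  Girsanov transform is needed. This gives (ii) and (iii) by comparison with a drift that is constant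
  or already understood.

  For the existence in (i), the Lipschitz drifts \<open>SUP q\<in>\<rat>. b t q - n * \<bar>x - q\<bar>\<close> decrease in \<open>n\<close>, so
  that their solutions, which are adapted as limits of Picard iterations, decrease as well. Their
  limit differs from \<open>R\<close> by a Lipschitz path, hence it is almost always at a continuity point of
  the drift and dominated convergence applies.
\<close>

section \<open>Comparison of integral equations\<close>

text \<open>\<open>X\<close> depends on the whole past of \<open>R\<close>, so the law of
  \<open>X t\<close> is not at hand. Passing to pairs of times in a level set leaves a statement
  about increments of \<open>R\<close> alone. Of these only an upper bound for the modulus of the
  characteristic function is used: the past contributes a factor of modulus at most 1, so its joint
  law with the increment never has to be computed. The ball radius is of order
  \<open>\<bar>t - s\<bar>\<close>, the deviation of order \<open>\<bar>t - s\<bar> powr H\<close>,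
  and \<open>H < 1\<close> makes the quotient vanish as \<open>t\<close> tends to \<open>s\<close>.

  In the existence proof, a compactness argument would give limits along subsequences that depend on
  the path, and adaptedness would be lost. A monotone sequence converges as a whole, so the solution
  is one fixed function of the driving path, built from integrals and pointwise limits. There is no
  circularity: the limit is shown to differ from \<open>R\<close> by a Lipschitz path before it is
  known to solve anything, and only then is the level-set result applied to it.\<close>

lemma continuous_on_indefinite_set_integral:
  fixes h :: "real \<Rightarrow> real"
  assumes "set_integrable lborel {a..b} h"
  shows "continuous_on {a..b} (\<lambda>t. LINT s:{a..t}|lborel. h s)"
proof -
  have "h integrable_on {a..b}" 
    using set_borel_integral_eq_integral(1)[OF assms] .
  from indefinite_integral_continuous_1[OF this]
  show ?thesis
  proof (rule continuous_on_eq)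
    fix t assume t: "t \<in> {a..b}"
    have "set_integrable lborel {a..t} h"
      by (rule set_integrable_subset[OF assms]) (use t in auto)
    from set_borel_integral_eq_integral(2)[OF this]
    show "integral {a..t} h = (LINT s:{a..t}|lborel. h s)" by simp
  qed
qed

lemma set_integral_split:
  fixes h :: "real \<Rightarrow> real"
  assumes "set_integrable lborel {a..t} h" "a \<le> s" "s \<le> t"
  shows "(LINT r:{a..t}|lborel. h r) = (LINT r:{a..s}|lborel. h r) + (LINT r:{s<..t}|lborel. h r)"
proof -
  have "{a..t} = {a..s} \<union> {s<..t}" using assms by auto
  moreover have "set_integrable lborel {a..s} h" "set_integrable lborel {s<..t} h"
    using assms by (auto intro!: set_integrable_subset[OF assms(1)])
  ultimately show ?thesis
    by (auto intro!: set_integral_Un)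
qed

lemma set_integral_nonneg:
  fixes f :: "'a \<Rightarrow> real"
  assumes "\<And>x. x \<in> A \<Longrightarrow> 0 \<le> f x"
  shows "0 \<le> (LINT x:A|M. f x)"
  unfolding set_lebesgue_integral_def
  using assms by (intro integral_nonneg_AE) (auto simp: indicator_def)

text \<open>With \<open>F\<close> the primitive of \<open>\<phi>\<close>, the function
  \<open>exp (- L * t) * F t\<close> has a nonpositive derivative and starts at 0. Hence
  \<open>F t \<le> 0\<close>, and the hypothesis passes this on to \<open>\<phi>\<close>. No sign of
  \<open>\<phi>\<close> is assumed.\<close>

lemma gronwall_nonpos:
  fixes \<phi> :: "real \<Rightarrow> real"
  assumes cont: "continuous_on {0..T} \<phi>" and L: "0 \<le> L"
    and le: "\<And>t. t \<in> {0..T} \<Longrightarrow> \<phi> t \<le> L * (LINT s:{0..t}|lborel. \<phi> s)"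
    and t: "t \<in> {0..T}"
  shows "\<phi> t \<le> 0"
proof -
  define F where "F = (\<lambda>t. integral {0..t} \<phi>)"
  have F_eq: "(LINT s:{0..t}|lborel. \<phi> s) = F t" if "t \<in> {0..T}" for t
  proof -
    have "set_integrable lborel {0..t} \<phi>"
      using that by (intro borel_integrable_atLeastAtMost' continuous_on_subset[OF cont]) auto
    from set_borel_integral_eq_integral(2)[OF this] show ?thesis by (simp add: F_def)
  qed
  have contF: "continuous_on {0..T} F"
    unfolding F_def
    by (intro indefinite_integral_continuous_1 integrable_continuous_real cont)
  have "exp (- L * t) * F t \<le> exp (- L * 0) * F 0"
  proof (rule DERIV_nonpos_imp_decreasing_open[where f = "\<lambda>t. exp (- L * t) * F t"])
    show "0 \<le> t" using t by simp
    show "continuous_on {0..t} (\<lambda>t. exp (- L * t) * F t)"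
      using t by (intro continuous_intros continuous_on_subset[OF contF]) auto
    fix x assume x: "0 < x" "x < t"
    then have "(F has_real_derivative \<phi> x) (at x within {0..T})"
      unfolding F_def using t by (intro integral_has_real_derivative cont) auto
    then have D: "(F has_real_derivative \<phi> x) (at x)"
      using x t by (simp add: at_within_Icc_at)
    have "((\<lambda>t. exp (- L * t) * F t) has_real_derivative exp (- L * x) * (\<phi> x - L * F x)) (at x)"
      by (auto intro!: derivative_eq_intros D simp: algebra_simps)
    moreover have "exp (- L * x) * (\<phi> x - L * F x) \<le> 0"
      using le[of x] F_eq[of x] x t by (intro mult_nonneg_nonpos) auto
    ultimately show "\<exists>y. ((\<lambda>t. exp (- L * t) * F t) has_real_derivative y) (at x) \<and> y \<le> 0"
      by blast
  qed
  then have "F t \<le> 0" by (simp add: F_def mult_le_0_iff)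
  with le[OF t] F_eq[OF t] L show ?thesis
    by (metis mult_nonneg_nonpos order_trans)
qed

text \<open>Gronwall for the positive part of \<open>D\<close>. If \<open>D t > 0\<close>, let
  \<open>s\<close> be the last earlier time with \<open>D s \<le> 0\<close>, which exists since
  \<open>D 0 = 0\<close> and \<open>D\<close> is continuous. On \<open>(s, t]\<close> the bound on
  \<open>h\<close> is available, so \<open>D t\<close> is at most \<open>L\<close> times the
  integral of the positive part.\<close>

lemma comparison_nonpos:
  fixes D h :: "real \<Rightarrow> real"
  assumes h: "set_integrable lborel {0..T} h" and L: "0 \<le> L"
    and D: "\<And>t. t \<in> {0..T} \<Longrightarrow> D t = (LINT s:{0..t}|lborel. h s)"
    and le: "\<And>s. s \<in> {0..T} \<Longrightarrow> 0 < D s \<Longrightarrow> h s \<le> L * D s"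
    and t: "t \<in> {0..T}"
  shows "D t \<le> 0"
proof -
  have contD: "continuous_on {0..T} D"
    by (rule continuous_on_eq[OF continuous_on_indefinite_set_integral[OF h]]) (simp add: D)
  let ?p = "\<lambda>s. max (D s) 0"
  have contp: "continuous_on {0..T} ?p" by (intro continuous_intros contD)
  have intp: "set_integrable lborel A ?p" if "A \<subseteq> {0..T}" "A \<in> sets lborel" for A
    by (rule set_integrable_subset[OF borel_integrable_atLeastAtMost'[OF contp]]) (use that in auto)
  have "?p t \<le> L * (LINT s:{0..t}|lborel. ?p s)" if t: "t \<in> {0..T}" for t
  proof (cases "D t \<le> 0")
    case True
    then show ?thesis using L
      by (auto intro!: mult_nonneg_nonneg set_integral_nonneg)
  next
    case False
    define Z where "Z = {r \<in> {0..t}. D r \<le> 0}"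
    have "D 0 = 0"
      using D[of 0] t set_borel_integral_eq_integral(2)[OF set_integrable_subset[OF h, of "{0..0}"]]
      by simp
    then have "0 \<in> Z" using t by (simp add: Z_def)
    have "closed Z" unfolding Z_def
      using t by (intro continuous_on_closed_Collect_le continuous_on_subset[OF contD] continuous_intros) auto
    moreover have bdd: "bdd_above Z" unfolding Z_def by (auto intro!: bdd_aboveI[of _ t])
    ultimately have s: "Sup Z \<in> Z" using closed_contains_Sup \<open>0 \<in> Z\<close> by blast
    define s where "s = Sup Z"
    have sZ: "0 \<le> s" "s \<le> t" "D s \<le> 0" using s by (auto simp: s_def Z_def)
    have pos: "0 < D r" if "r \<in> {s<..t}" for r
      using that sZ cSup_upper[OF _ bdd, of r] by (force simp: Z_def s_def)
    have "D t = D s + (LINT r:{s<..t}|lborel. h r)"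
      using set_integral_split[of 0 t h s] D[of t] D[of s] t sZ set_integrable_subset[OF h, of "{0..t}"]
      by auto
    also have "\<dots> \<le> (LINT r:{s<..t}|lborel. h r)" using sZ by simp
    also have "\<dots> \<le> (LINT r:{s<..t}|lborel. L * ?p r)"
      using t sZ pos le
      by (intro set_integral_mono set_integrable_subset[OF h] set_integrable_mult_right intp) fastforce+
    also have "\<dots> = L * (LINT r:{s<..t}|lborel. ?p r)" by simp
    also have "\<dots> \<le> L * (LINT r:{0..t}|lborel. ?p r)"
      using t sZ L
      by (intro mult_left_mono) (auto simp: set_integral_split[OF intp, of 0 t s] intro!: set_integral_nonneg)
    finally show ?thesis using False by simp
  qed
  from gronwall_nonpos[OF contp L this t] show ?thesis by simp
qed

lemma continuous_on_Icc_abs_le: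
  fixes y :: "real \<Rightarrow> real"
  assumes "continuous_on {a..b} y"
  obtains B where "\<And>s. s \<in> {a..b} \<Longrightarrow> \<bar>y s\<bar> \<le> B"
proof -
  have "bounded (y ` {a..b})"
    by (intro compact_imp_bounded compact_continuous_image assms compact_Icc)
  then obtain B where "\<forall>x\<in>y ` {a..b}. norm x \<le> B" unfolding bounded_iff by blast
  with that[of B] show ?thesis by auto
qed

lemma integrable_indicator_Icc: "integrable lborel (\<lambda>s::real. indicator {a..b} s * (K::real))"
  using borel_integrable_atLeastAtMost'[of a b "\<lambda>_. K"] by (simp add: set_integrable_def)

lemma set_integrable_bounded:
  fixes f :: "real \<Rightarrow> real"
  assumes "set_borel_measurable lborel {a..b} f" "\<And>s. s \<in> {a..b} \<Longrightarrow> \<bar>f s\<bar> \<le> K"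
  shows "set_integrable lborel {a..b} f"
  unfolding set_integrable_def
proof (rule Bochner_Integration.integrable_bound)
  show "integrable lborel (\<lambda>s. indicator {a..b} s * K)"
    by (rule integrable_indicator_Icc)
  show "(\<lambda>s. indicator {a..b} s *\<^sub>R f s) \<in> borel_measurable lborel"
    using assms(1) unfolding set_borel_measurable_def .
  show "AE s in lborel. norm (indicator {a..b} s *\<^sub>R f s) \<le> norm (indicator {a..b} s * K)"
    using assms(2) by (intro AE_I2) (auto simp: indicator_def intro: order_trans[OF _ abs_ge_self])
qed

text \<open>Off \<open>{0..t}\<close> nothing is known about \<open>y\<close>. Cutting it off by an
  indicator makes it Borel, and the outer indicator hides the change.\<close>

lemma set_borel_measurable_path:
  fixes g :: "real \<Rightarrow> real \<Rightarrow> real"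
  assumes g[measurable]: "case_prod g \<in> borel_measurable (borel \<Otimes>\<^sub>M borel)"
    and y: "continuous_on {0..t} y"
  shows "set_borel_measurable lborel {0..t} (\<lambda>s. g s (y s))"
proof -
  have [measurable]: "(\<lambda>s. indicator {0..t} s *\<^sub>R y s) \<in> borel_measurable borel"
    using y by (intro borel_measurable_continuous_on_indicator) auto
  have "(\<lambda>s. indicator {0..t} s *\<^sub>R g s (indicator {0..t} s *\<^sub>R y s)) \<in> borel_measurable borel"
    by measurable
  also have "(\<lambda>s. indicator {0..t} s *\<^sub>R g s (indicator {0..t} s *\<^sub>R y s))
    = (\<lambda>s. indicator {0..t} s *\<^sub>R g s (y s))"
    by (auto simp: indicator_def)
  finally show ?thesis by (simp add: set_borel_measurable_def)
qed

lemma set_integrable_path: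
  fixes g :: "real \<Rightarrow> real \<Rightarrow> real"
  assumes g: "case_prod g \<in> borel_measurable (borel \<Otimes>\<^sub>M borel)"
    and growth: "\<And>s x. \<bar>g s x\<bar> \<le> C * (1 + \<bar>x\<bar>)"
    and y: "continuous_on {0..t} y"
  shows "set_integrable lborel {0..t} (\<lambda>s. g s (y s))"
proof -
  have C: "0 \<le> C" using growth[of 0 0] by simp
  obtain B where B: "\<And>s. s \<in> {0..t} \<Longrightarrow> \<bar>y s\<bar> \<le> B"
    using continuous_on_Icc_abs_le[OF y] by blast
  show ?thesis
  proof (rule set_integrable_bounded[OF set_borel_measurable_path[OF g y]])
    fix s assume "s \<in> {0..t}"
    then show "\<bar>g s (y s)\<bar> \<le> C * (1 + B)"
      using growth[of s "y s"] B[of s] mult_left_mono[OF _ C, of "1 + \<bar>y s\<bar>" "1 + B"] by simp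
  qed
qed

lemma abs_set_integral_le:
  fixes f k :: "'a \<Rightarrow> real"
  assumes "set_integrable M A f" "set_integrable M A k" "\<And>s. s \<in> A \<Longrightarrow> \<bar>f s\<bar> \<le> k s"
  shows "\<bar>LINT s:A|M. f s\<bar> \<le> (LINT s:A|M. k s)"
proof -
  have "\<bar>LINT s:A|M. f s\<bar> \<le> (LINT s:A|M. \<bar>f s\<bar>)"
    using set_integral_norm_bound[OF assms(1)] by simp
  also have "\<dots> \<le> (LINT s:A|M. k s)"
    using assms by (intro set_integral_mono set_integrable_abs)
  finally show ?thesis .
qed

lemma set_integral_exp:
  assumes "0 \<le> t"
  shows "(LINT s:{0..t}|lborel. L * exp (L * s)) = exp (L * t) - (1::real)"
proof -
  have "((\<lambda>s. L * exp (L * s)) has_integral exp (L * t) - exp (L * 0)) {0..t}"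
    using assms
    by (intro fundamental_theorem_of_calculus)
       (auto intro!: derivative_eq_intros simp flip: has_real_derivative_iff_has_vector_derivative)
  moreover have "set_integrable lborel {0..t} (\<lambda>s. L * exp (L * s))"
    by (intro borel_integrable_atLeastAtMost' continuous_intros)
  ultimately show ?thesis
    by (metis set_borel_integral_eq_integral(2) integral_unique exp_zero mult_zero_right)
qed

section \<open>Picard iteration\<close>

text \<open>Explicit iterates, rather than a fixed point in a path space, let adaptedness pass from
  one iterate to the next. The path \<open>r\<close> also carries the initial value.\<close>

primrec picard :: "(real \<Rightarrow> real \<Rightarrow> real) \<Rightarrow> (real \<Rightarrow> real) \<Rightarrow> nat \<Rightarrow> real \<Rightarrow> real" where
  "picard g r 0 t = r t"
| "picard g r (Suc k) t = r t + (LINT s:{0..t}|lborel. g s (picard g r k s))"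

lemma continuous_on_picard:
  fixes g :: "real \<Rightarrow> real \<Rightarrow> real"
  assumes g: "case_prod g \<in> borel_measurable (borel \<Otimes>\<^sub>M borel)"
    and growth: "\<And>s x. \<bar>g s x\<bar> \<le> C * (1 + \<bar>x\<bar>)"
    and r: "continuous_on {0..T} r"
  shows "continuous_on {0..T} (picard g r k)"
proof (induction k)
  case 0
  then show ?case using r by (simp add: picard.simps(1)[abs_def])
next
  case (Suc k)
  show ?case unfolding picard.simps(2)[abs_def]
    by (intro continuous_on_add r continuous_on_indefinite_set_integral set_integrable_path[OF g growth Suc])
qed

text \<open>Increments decay geometrically in the supremum norm with weight
  \<open>exp (- 2 * L * t)\<close> (Bielecki's norm), so that convergence is uniform on the whole of
  \<open>{0..T}\<close> at once, however large \<open>L * T\<close> is.\<close>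

lemma picard_converges:
  fixes g :: "real \<Rightarrow> real \<Rightarrow> real"
  assumes g: "case_prod g \<in> borel_measurable (borel \<Otimes>\<^sub>M borel)"
    and growth: "\<And>s x. \<bar>g s x\<bar> \<le> C * (1 + \<bar>x\<bar>)"
    and lip: "\<And>s x y. \<bar>g s x - g s y\<bar> \<le> L * \<bar>x - y\<bar>"
    and r: "continuous_on {0..T} r" and T: "0 \<le> T"
  obtains y where "continuous_on {0..T} y"
    and "\<And>t. t \<in> {0..T} \<Longrightarrow> (\<lambda>k. picard g r k t) \<longlonglongrightarrow> y t"
    and "\<And>t. t \<in> {0..T} \<Longrightarrow> y t = r t + (LINT s:{0..t}|lborel. g s (y s))"
proof -
  let ?y = "picard g r"
  note cont = continuous_on_picard[OF g growth r]
  have int: "set_integrable lborel {0..t} (\<lambda>s. g s (?y k s))" if "t \<in> {0..T}" for t k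
    using that by (intro set_integrable_path[OF g growth] continuous_on_subset[OF cont]) auto
  have L: "0 \<le> L" using lip[of 0 0 1] by (simp add: order.trans[OF abs_ge_zero])
  have C: "0 \<le> C" using growth[of 0 0] by simp
  obtain R where R: "\<And>s. s \<in> {0..T} \<Longrightarrow> \<bar>r s\<bar> \<le> R"
    using continuous_on_Icc_abs_le[OF r] by blast
  have R0: "0 \<le> R" using R[of 0] T by simp
  \<comment> \<open>A bound for the first increment: \<open>g s (r s)\<close> has modulus at most
    \<open>C * (1 + R)\<close> and is integrated over a length of at most \<open>T\<close>.\<close>
  define B where "B = T * (C * (1 + R))"
  have B: "0 \<le> B" using T C R0 by (simp add: B_def)
  \<comment> \<open>The integral of \<open>2 * L * exp (2 * L * s)\<close> reproduces the weight up
    to \<open>- 1\<close>; the Lipschitz bound supplies only \<open>L\<close>, which leaves the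
    factor 1/2.\<close>
  have step: "\<bar>?y (Suc k) t - ?y k t\<bar> \<le> B * (1/2)^k * exp (2 * L * t)" if t: "t \<in> {0..T}" for t k
    using t
  proof (induction k arbitrary: t)
    case 0
    have "\<bar>LINT s:{0..t}|lborel. g s (?y 0 s)\<bar> \<le> (LINT s:{0..t}|lborel. C * (1 + R))"
    proof (rule abs_set_integral_le[OF int[OF 0]])
      show "set_integrable lborel {0..t} (\<lambda>s. C * (1 + R))"
        by (intro borel_integrable_atLeastAtMost' continuous_intros)
      fix s assume "s \<in> {0..t}"
      then show "\<bar>g s (?y 0 s)\<bar> \<le> C * (1 + R)"
        using growth[of s "r s"] R[of s] 0 mult_left_mono[OF _ C, of "1 + \<bar>r s\<bar>" "1 + R"] by simp
    qed
    also have "\<dots> = t * (C * (1 + R))" using 0 by (simp add: set_lebesgue_integral_def)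
    also have "\<dots> \<le> B" unfolding B_def using 0 C R0 by (intro mult_right_mono) auto
    also have "\<dots> \<le> B * exp (2 * L * t)"
      using B L 0 by (simp add: mult_le_cancel_left1)
    finally show ?case by simp
  next
    case (Suc k)
    have eq: "?y (Suc (Suc k)) t - ?y (Suc k) t
      = (LINT s:{0..t}|lborel. g s (?y (Suc k) s) - g s (?y k s))"
      by (subst set_integral_diff(2)) (use int Suc.prems in \<open>auto simp del: picard.simps(2) simp: picard.simps(2)[of _ _ _ t]\<close>)
    have "\<bar>LINT s:{0..t}|lborel. g s (?y (Suc k) s) - g s (?y k s)\<bar>
      \<le> (LINT s:{0..t}|lborel. B * (1/2)^Suc k * (2 * L * exp (2 * L * s)))"
    proof (rule abs_set_integral_le)
      show "set_integrable lborel {0..t} (\<lambda>s. g s (?y (Suc k) s) - g s (?y k s))"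
        by (intro set_integral_diff(1) int Suc.prems)
      show "set_integrable lborel {0..t} (\<lambda>s. B * (1/2)^Suc k * (2 * L * exp (2 * L * s)))"
        by (intro borel_integrable_atLeastAtMost' continuous_intros)
      fix s assume "s \<in> {0..t}"
      then have "L * \<bar>?y (Suc k) s - ?y k s\<bar> \<le> L * (B * (1/2)^k * exp (2 * L * s))"
        using Suc.prems by (intro mult_left_mono Suc.IH L) auto
      with lip[of s "?y (Suc k) s" "?y k s"]
      show "\<bar>g s (?y (Suc k) s) - g s (?y k s)\<bar> \<le> B * (1/2)^Suc k * (2 * L * exp (2 * L * s))"
        by (simp add: algebra_simps del: picard.simps)
    qed
    also have "\<dots> = B * (1/2)^Suc k * (LINT s:{0..t}|lborel. (2 * L) * exp (2 * L * s))"
      by (simp only: set_integral_mult_right)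
    also have "\<dots> = B * (1/2)^Suc k * (exp (2 * L * t) - 1)"
      using set_integral_exp[of t "2 * L"] Suc.prems by (simp only: atLeastAtMost_iff)
    also have "\<dots> \<le> B * (1/2)^Suc k * exp (2 * L * t)"
      using B by (intro mult_left_mono) auto
    finally show ?case by (simp only: eq)
  qed
  define b where "b = (\<lambda>k. B * exp (2 * L * T) * (1/2)^k)"
  have b: "\<bar>?y (Suc k) t - ?y k t\<bar> \<le> b k" if t: "t \<in> {0..T}" for t k
  proof -
    have "B * (1/2)^k * exp (2 * L * t) \<le> B * (1/2)^k * exp (2 * L * T)"
      using B L t by (intro mult_left_mono) (auto intro: mult_left_mono)
    with step[OF t, of k] show ?thesis by (simp add: b_def mult_ac del: picard.simps)
  qed
  have sb: "summable b" unfolding b_def by (intro summable_mult summable_geometric) simp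
  have b0: "0 \<le> b k" for k using B by (simp add: b_def)
  have ysum: "?y n t = r t + (\<Sum>k<n. ?y (Suc k) t - ?y k t)" for n t
    using sum_lessThan_telescope[of "\<lambda>k. ?y k t" n] by (simp del: picard.simps(2))
  define y where "y = (\<lambda>t. r t + (\<Sum>k. ?y (Suc k) t - ?y k t))"
  have "uniform_limit {0..T} (\<lambda>n t. \<Sum>k<n. ?y (Suc k) t - ?y k t) (\<lambda>t. \<Sum>k. ?y (Suc k) t - ?y k t) sequentially"
    by (rule Weierstrass_m_test[OF _ sb]) (use b in auto)
  from uniform_limit_add[OF uniform_limit_const[where c = r] this]
  have lim: "uniform_limit {0..T} ?y y sequentially"
    by (rule uniform_limit_cong'[THEN iffD1, rotated 2]) (rule ysum[symmetric], simp only: y_def)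
  have conty: "continuous_on {0..T} y"
    by (rule uniform_limit_theorem[OF _ lim]) (auto intro!: always_eventually cont)
  have tend: "(\<lambda>k. ?y k t) \<longlonglongrightarrow> y t" if "t \<in> {0..T}" for t
    by (rule tendsto_uniform_limitI[OF lim that])
  have yb: "\<bar>?y n t\<bar> \<le> R + suminf b" if t: "t \<in> {0..T}" for n t
  proof -
    have "\<bar>\<Sum>k<n. ?y (Suc k) t - ?y k t\<bar> \<le> (\<Sum>k<n. \<bar>?y (Suc k) t - ?y k t\<bar>)"
      by (rule sum_abs)
    also have "\<dots> \<le> (\<Sum>k<n. b k)" by (intro sum_mono b t)
    also have "\<dots> \<le> suminf b" by (intro sum_le_suminf sb) (auto simp: b0)
    finally show ?thesis using R[OF t] ysum[of n t] by linarith
  qed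
  have "y t = r t + (LINT s:{0..t}|lborel. g s (y s))" if t: "t \<in> {0..T}" for t
  proof -
    have "(\<lambda>k. LINT s:{0..t}|lborel. g s (?y k s)) \<longlonglongrightarrow> (LINT s:{0..t}|lborel. g s (y s))"
      unfolding set_lebesgue_integral_def
    proof (rule integral_dominated_convergence)
      show "(\<lambda>s. indicator {0..t} s *\<^sub>R g s (y s)) \<in> borel_measurable lborel"
        using set_borel_measurable_path[OF g continuous_on_subset[OF conty], of t] t
        by (auto simp: set_borel_measurable_def)
      show "(\<lambda>s. indicator {0..t} s *\<^sub>R g s (?y k s)) \<in> borel_measurable lborel" for k
        using set_borel_measurable_path[OF g continuous_on_subset[OF cont], of t k] t
        by (auto simp: set_borel_measurable_def)
      show "integrable lborel (\<lambda>s. indicator {0..t} s * (C * (1 + (R + suminf b))))"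
        by (rule integrable_indicator_Icc)
      show "AE s in lborel. (\<lambda>k. indicator {0..t} s *\<^sub>R g s (?y k s)) \<longlonglongrightarrow> indicator {0..t} s *\<^sub>R g s (y s)"
      proof (rule AE_I2)
        fix s
        have "(\<lambda>k. g s (?y k s)) \<longlonglongrightarrow> g s (y s)" if "s \<in> {0..t}"
        proof -
          have "(\<lambda>k. L * \<bar>?y k s - y s\<bar>) \<longlonglongrightarrow> L * \<bar>y s - y s\<bar>"
            using that t by (intro tendsto_intros tend) auto
          then have "(\<lambda>k. L * \<bar>?y k s - y s\<bar>) \<longlonglongrightarrow> 0" by simp
          moreover have "\<forall>\<^sub>F k in sequentially. norm (g s (?y k s) - g s (y s)) \<le> L * \<bar>?y k s - y s\<bar>"
            unfolding real_norm_def by (intro always_eventually allI lip)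
          ultimately have "(\<lambda>k. g s (?y k s) - g s (y s)) \<longlonglongrightarrow> 0"
            by (rule Lim_null_comparison[rotated])
          then show ?thesis by (rule LIM_zero_cancel)
        qed
        then show "(\<lambda>k. indicator {0..t} s *\<^sub>R g s (?y k s)) \<longlonglongrightarrow> indicator {0..t} s *\<^sub>R g s (y s)"
          by (cases "s \<in> {0..t}") (auto intro: tendsto_scaleR)
      qed
      show "AE s in lborel. norm (indicator {0..t} s *\<^sub>R g s (?y k s)) \<le> indicator {0..t} s * (C * (1 + (R + suminf b)))" for k
      proof (rule AE_I2)
        fix s
        show "norm (indicator {0..t} s *\<^sub>R g s (?y k s)) \<le> indicator {0..t} s * (C * (1 + (R + suminf b)))"
          using growth[of s "?y k s"] yb[of s k] t
            mult_left_mono[OF _ C, of "1 + \<bar>?y k s\<bar>" "1 + (R + suminf b)"]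
          by (auto simp: indicator_def)
      qed
    qed
    from tendsto_add[OF tendsto_const[of "r t"] this]
    have "(\<lambda>k. ?y (Suc k) t) \<longlonglongrightarrow> r t + (LINT s:{0..t}|lborel. g s (y s))" by simp
    with LIMSEQ_Suc[OF tend[OF t]] show ?thesis by (rule LIMSEQ_unique)
  qed
  with that conty tend show ?thesis by blast
qed


text \<open>Since \<open>lim\<close> is total, this is a function of the path \<open>r\<close>
  alone, and measurability in a parameter of \<open>r\<close> needs no proof of convergence.\<close>

definition picard_limit :: "(real \<Rightarrow> real \<Rightarrow> real) \<Rightarrow> (real \<Rightarrow> real) \<Rightarrow> real \<Rightarrow> real" where
  "picard_limit g r t = lim (\<lambda>k. picard g r k t)"

lemma picard_limit:
  fixes g :: "real \<Rightarrow> real \<Rightarrow> real"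
  assumes g: "case_prod g \<in> borel_measurable (borel \<Otimes>\<^sub>M borel)"
    and growth: "\<And>s x. \<bar>g s x\<bar> \<le> C * (1 + \<bar>x\<bar>)"
    and lip: "\<And>s x y. \<bar>g s x - g s y\<bar> \<le> L * \<bar>x - y\<bar>"
    and r: "continuous_on {0..T} r" and T: "0 \<le> T"
  shows "continuous_on {0..T} (picard_limit g r)"
    and "t \<in> {0..T} \<Longrightarrow> set_integrable lborel {0..t} (\<lambda>s. g s (picard_limit g r s))"
    and "t \<in> {0..T} \<Longrightarrow> picard_limit g r t = r t + (LINT s:{0..t}|lborel. g s (picard_limit g r s))"
proof -
  obtain y where y: "continuous_on {0..T} y"
    "\<And>t. t \<in> {0..T} \<Longrightarrow> (\<lambda>k. picard g r k t) \<longlonglongrightarrow> y t"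
    "\<And>t. t \<in> {0..T} \<Longrightarrow> y t = r t + (LINT s:{0..t}|lborel. g s (y s))"
    using picard_converges[OF g growth lip r T] by blast
  have eq: "picard_limit g r t = y t" if "t \<in> {0..T}" for t
    unfolding picard_limit_def by (rule limI[OF y(2)[OF that]])
  show cont: "continuous_on {0..T} (picard_limit g r)"
    by (rule continuous_on_eq[OF y(1)]) (simp add: eq)
  show "set_integrable lborel {0..t} (\<lambda>s. g s (picard_limit g r s))" if "t \<in> {0..T}"
    using that by (intro set_integrable_path[OF g growth] continuous_on_subset[OF cont]) auto
  show "picard_limit g r t = r t + (LINT s:{0..t}|lborel. g s (picard_limit g r s))" if t: "t \<in> {0..T}"
  proof -
    have "(LINT s:{0..t}|lborel. g s (picard_limit g r s)) = (LINT s:{0..t}|lborel. g s (y s))"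
      using t eq by (intro set_lebesgue_integral_cong) auto
    then show ?thesis using y(3)[OF t] eq[OF t] by simp
  qed
qed

text \<open>The hypothesis \<open>le\<close> is shaped for three uses: ordered drifts of which the
  larger is Lipschitz, ordered drifts of which the smaller is Lipschitz, and one non-increasing
  drift with \<open>L = 0\<close>.\<close>

lemma solutions_le:
  fixes g h :: "real \<Rightarrow> real \<Rightarrow> real"
  assumes X: "\<And>t. t \<in> {0..T} \<Longrightarrow> X t = r t + (LINT s:{0..t}|lborel. g s (X s))"
    and Y: "\<And>t. t \<in> {0..T} \<Longrightarrow> Y t = r t + (LINT s:{0..t}|lborel. h s (Y s))"
    and iX: "set_integrable lborel {0..T} (\<lambda>s. g s (X s))"
    and iY: "set_integrable lborel {0..T} (\<lambda>s. h s (Y s))"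
    and le: "\<And>s x y. s \<in> {0..T} \<Longrightarrow> y < x \<Longrightarrow> g s x - h s y \<le> L * (x - y)" and L: "0 \<le> L"
    and t: "t \<in> {0..T}"
  shows "X t \<le> Y t"
proof -
  have "X t - Y t \<le> 0"
  proof (rule comparison_nonpos[OF set_integral_diff(1)[OF iX iY] L _ _ t])
    show "X t - Y t = (LINT s:{0..t}|lborel. g s (X s) - h s (Y s))" if "t \<in> {0..T}" for t
    proof -
      have "set_integrable lborel {0..t} (\<lambda>s. g s (X s))" "set_integrable lborel {0..t} (\<lambda>s. h s (Y s))"
        using that by (auto intro!: set_integrable_subset[OF iX] set_integrable_subset[OF iY])
      from set_integral_diff(2)[OF this] show ?thesis using X[OF that] Y[OF that] by simp
    qed
    show "g s (X s) - h s (Y s) \<le> L * (X s - Y s)" if "s \<in> {0..T}" "0 < X s - Y s" for s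
      using that by (intro le) auto
  qed
  then show ?thesis by simp
qed

section \<open>Approximation of the drift by sup-convolutions\<close>

text \<open>The Lipschitz (Pasch-Hausdorff) envelope from above. Restricting the supremum to
  rationals makes it countable, hence measurable in \<open>(t, x)\<close>. The price is that it need
  not dominate \<open>b\<close> at discontinuities; at continuity points it still converges to
  \<open>b\<close>.\<close>

definition sup_conv :: "(real \<Rightarrow> real \<Rightarrow> real) \<Rightarrow> nat \<Rightarrow> real \<Rightarrow> real \<Rightarrow> real" where
  "sup_conv b n t x = (SUP q\<in>\<rat>. b t q - real n * \<bar>x - q\<bar>)"

context
  fixes b :: "real \<Rightarrow> real \<Rightarrow> real" and C :: real
  assumes growth: "\<And>t x. \<bar>b t x\<bar> \<le> C * (1 + \<bar>x\<bar>)"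
begin

lemma growth_const_nonneg: "0 \<le> C"
  using growth[of 0 0] by simp

text \<open>By the triangle inequality the growth of \<open>b\<close> away from \<open>x\<close>
  costs at most \<open>C * \<bar>x - q\<bar>\<close>, which the penalty absorbs once
  \<open>C \<le> real n\<close>. So the supremum is finite and keeps the growth constant
  \<open>C\<close> for every such \<open>n\<close>.\<close>

lemma sup_conv_term_le:
  assumes "C \<le> real n"
  shows "b t q - real n * \<bar>x - q\<bar> \<le> C * (1 + \<bar>x\<bar>)"
proof -
  have "b t q \<le> C * (1 + \<bar>q\<bar>)" using growth[of t q] by simp
  also have "\<dots> \<le> C * (1 + \<bar>x\<bar> + \<bar>x - q\<bar>)"
    using growth_const_nonneg by (intro mult_left_mono) auto
  also have "\<dots> = C * (1 + \<bar>x\<bar>) + C * \<bar>x - q\<bar>" by (simp add: algebra_simps)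
  also have "\<dots> \<le> C * (1 + \<bar>x\<bar>) + real n * \<bar>x - q\<bar>"
    using assms by (intro add_left_mono mult_right_mono) auto
  finally show ?thesis by simp
qed

lemma sup_conv_bdd_above:
  assumes "C \<le> real n"
  shows "bdd_above ((\<lambda>q. b t q - real n * \<bar>x - q\<bar>) ` A)"
  using sup_conv_term_le[OF assms] by (intro bdd_aboveI[of _ "C * (1 + \<bar>x\<bar>)"]) auto

lemma sup_conv_ge:
  assumes "C \<le> real n" "q \<in> \<rat>"
  shows "b t q - real n * \<bar>x - q\<bar> \<le> sup_conv b n t x"
  unfolding sup_conv_def by (rule cSUP_upper[OF assms(2) sup_conv_bdd_above[OF assms(1)]])

lemma sup_conv_le:
  assumes "\<And>q. q \<in> \<rat> \<Longrightarrow> b t q - real n * \<bar>x - q\<bar> \<le> u"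
  shows "sup_conv b n t x \<le> u"
  unfolding sup_conv_def using assms Rats_0 by (intro cSUP_least) auto

text \<open>For the lower bound \<open>q = x\<close> would do if \<open>x\<close> were rational;
  otherwise a rational near \<open>x\<close> is taken and an error \<open>e\<close> is
  allowed.\<close>

lemma sup_conv_abs_le:
  assumes "C \<le> real n"
  shows "\<bar>sup_conv b n t x\<bar> \<le> C * (1 + \<bar>x\<bar>)"
proof (rule abs_leI)
  show "sup_conv b n t x \<le> C * (1 + \<bar>x\<bar>)"
    by (intro sup_conv_le sup_conv_term_le assms)
  show "- sup_conv b n t x \<le> C * (1 + \<bar>x\<bar>)"
  proof (rule field_le_epsilon)
    fix e :: real assume e: "0 < e"
    \<comment> \<open>The growth bound at \<open>q\<close> loses \<open>C * d\<close> and the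
      penalty \<open>real n * d\<close>, together at most \<open>e\<close>. The summand 1 keeps the
      denominator positive when \<open>C\<close> and \<open>n\<close> are 0.\<close>
    define d where "d = e / (C + real n + 1)"
    have d: "0 < d" using e growth_const_nonneg by (simp add: d_def)
    obtain q where q: "q \<in> \<rat>" "x < q" "q < x + d" using Rats_dense_in_real[of x "x + d"] d by auto
    have "- b t q \<le> C * (1 + \<bar>q\<bar>)" using growth[of t q] by simp
    also have "\<dots> \<le> C * (1 + \<bar>x\<bar> + d)"
      using growth_const_nonneg q by (intro mult_left_mono) auto
    finally have "- b t q \<le> C * (1 + \<bar>x\<bar>) + C * d" by (simp add: algebra_simps)
    moreover have "real n * \<bar>x - q\<bar> \<le> real n * d"
      using q by (intro mult_left_mono) auto
    moreover have "C * d + real n * d \<le> e"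
    proof -
      have "(C + real n) * d \<le> (C + real n + 1) * d" using d by (intro mult_right_mono) auto
      also have "\<dots> = e" using growth_const_nonneg by (simp add: d_def)
      finally show ?thesis by (simp add: distrib_right)
    qed
    ultimately show "- sup_conv b n t x \<le> C * (1 + \<bar>x\<bar>) + e"
      using sup_conv_ge[OF assms q(1), of t x] by linarith
  qed
qed

lemma sup_conv_lipschitz:
  assumes "C \<le> real n"
  shows "\<bar>sup_conv b n t x - sup_conv b n t y\<bar> \<le> real n * \<bar>x - y\<bar>"
proof -
  have *: "sup_conv b n t x \<le> sup_conv b n t y + real n * \<bar>x - y\<bar>" for x y
  proof (rule sup_conv_le)
    fix q :: real assume "q \<in> \<rat>"
    have "real n * \<bar>y - q\<bar> \<le> real n * (\<bar>x - q\<bar> + \<bar>x - y\<bar>)"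
      by (intro mult_left_mono) auto
    then show "b t q - real n * \<bar>x - q\<bar> \<le> sup_conv b n t y + real n * \<bar>x - y\<bar>"
      using sup_conv_ge[OF assms \<open>q \<in> \<rat>\<close>, of t y] by (simp add: distrib_left)
  qed
  from *[of x y] *[of y x] show ?thesis by (simp add: abs_le_iff abs_minus_commute)
qed

lemma sup_conv_antimono:
  assumes "C \<le> real m" "m \<le> n"
  shows "sup_conv b n t x \<le> sup_conv b m t x"
proof (rule sup_conv_le)
  fix q :: real assume q: "q \<in> \<rat>"
  have "real m * \<bar>x - q\<bar> \<le> real n * \<bar>x - q\<bar>" using assms by (intro mult_right_mono) auto
  then show "b t q - real n * \<bar>x - q\<bar> \<le> sup_conv b m t x"
    using sup_conv_ge[OF assms(1) q, of t x] by linarith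
qed

lemma borel_measurable_sup_conv:
  assumes b: "case_prod b \<in> borel_measurable (borel \<Otimes>\<^sub>M borel)" and n: "C \<le> real n"
  shows "case_prod (sup_conv b n) \<in> borel_measurable (borel \<Otimes>\<^sub>M borel)"
proof -
  have [measurable]: "(\<lambda>t. b t q) \<in> borel_measurable borel" for q
    using measurable_compose[OF _ b, of "\<lambda>t. (t, q)" borel] by simp
  have "(\<lambda>p. SUP q\<in>\<rat>. b (fst p) q - real n * \<bar>snd p - q\<bar>) \<in> borel_measurable (borel \<Otimes>\<^sub>M borel)"
    by (intro borel_measurable_cSUP countable_rat sup_conv_bdd_above n) measurable
  then show ?thesis by (simp add: sup_conv_def split_beta')
qed

text \<open>The argument \<open>y n\<close> moves together with the index, as the approximate
  solutions do. In the upper bound, rationals near \<open>x\<close> are handled by continuity. For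
  distant ones a penalty of slope \<open>N\<close> already controls the growth of \<open>b\<close>,
  and the remaining slope \<open>n\<close> pushes the term below \<open>b t x\<close>.\<close>

lemma sup_conv_tendsto:
  assumes cont: "isCont (b t) x" and y: "y \<longlonglongrightarrow> x" and N: "C \<le> real N"
  shows "(\<lambda>n. sup_conv b (N + n) t (y n)) \<longlonglongrightarrow> b t x"
proof (rule LIMSEQ_I)
  fix e :: real assume e: "0 < e"
  obtain d where d: "0 < d" and bd: "\<And>z. \<bar>z - x\<bar> < d \<Longrightarrow> \<bar>b t z - b t x\<bar> < e / 4"
    using cont[unfolded continuous_at_eps_delta, rule_format, of "e / 4"] e
    by (auto simp: dist_real_def)
  obtain n1 where n1: "\<And>n. n1 \<le> n \<Longrightarrow> \<bar>y n - x\<bar> < d / 2"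
    using LIMSEQ_D[OF y, of "d / 2"] d by (auto simp: real_norm_def)
  \<comment> \<open>From \<open>n2\<close> on, the surplus penalty over a distance of at least
    \<open>d / 2\<close> outweighs the gap between the growth bound near \<open>x\<close> and
    \<open>b t x\<close>.\<close>
  obtain n2 :: nat where n2: "C * (1 + \<bar>x\<bar> + d) - b t x < real n2 * (d / 2)"
    using reals_Archimedean3[of "d / 2"] d by (meson half_gt_zero)
  have close: "\<bar>sup_conv b (N + n) t (y n) - b t x\<bar> \<le> e / 2" if n: "max n1 n2 \<le> n" for n
  proof -
    have NC: "C \<le> real (N + n)" using N by simp
    have yn: "\<bar>y n - x\<bar> < d / 2" using n n1 by simp
    have up: "sup_conv b (N + n) t (y n) \<le> b t x + e / 2"
    proof (rule sup_conv_le)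
      fix q :: real assume "q \<in> \<rat>"
      show "b t q - real (N + n) * \<bar>y n - q\<bar> \<le> b t x + e / 2"
      proof (cases "\<bar>q - x\<bar> < d")
        case True
        have "0 \<le> real (N + n) * \<bar>y n - q\<bar>" by simp
        with bd[OF True] show ?thesis using e unfolding abs_less_iff by linarith
      next
        case False
        then have far: "d / 2 \<le> \<bar>y n - q\<bar>" using yn by linarith
        have "b t q - real N * \<bar>y n - q\<bar> \<le> C * (1 + \<bar>y n\<bar>)" by (rule sup_conv_term_le[OF N])
        also have "\<dots> \<le> C * (1 + \<bar>x\<bar> + d)"
        proof (rule mult_left_mono)
          show "1 + \<bar>y n\<bar> \<le> 1 + \<bar>x\<bar> + d" using yn d by linarith
        qed (rule growth_const_nonneg)
        also have "\<dots> \<le> b t x + real n2 * (d / 2)" using n2 by simp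
        also have "\<dots> \<le> b t x + real n * \<bar>y n - q\<bar>"
          using n far d by (intro add_left_mono mult_mono) auto
        finally show ?thesis using e by (simp add: algebra_simps)
      qed
    qed
    \<comment> \<open>The first term keeps \<open>q\<close> within \<open>d\<close> of
      \<open>x\<close>, the second keeps the penalty at \<open>q\<close> below
      \<open>e / 4\<close>.\<close>
    define d' where "d' = min (d / 2) (e / (4 * (real (N + n) + 1)))"
    have d': "0 < d'" using d e by (simp add: d'_def)
    obtain q where q: "q \<in> \<rat>" "y n < q" "q < y n + d'"
      using Rats_dense_in_real[of "y n" "y n + d'"] d' by auto
    have "\<bar>q - x\<bar> < d" using q yn min.cobounded1[of "d / 2"] unfolding d'_def by linarith
    from bd[OF this] have bq: "b t x - e / 4 < b t q" unfolding abs_less_iff by linarith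
    have "real (N + n) * \<bar>y n - q\<bar> \<le> real (N + n) * (e / (4 * (real (N + n) + 1)))"
    proof (rule mult_left_mono)
      show "\<bar>y n - q\<bar> \<le> e / (4 * (real (N + n) + 1))"
        using q min.cobounded2[of "d / 2" "e / (4 * (real (N + n) + 1))"] unfolding d'_def by linarith
    qed simp
    also have "\<dots> \<le> e / 4" using e by (simp add: field_simps)
    finally have "b t x - e / 2 \<le> sup_conv b (N + n) t (y n)"
      using sup_conv_ge[OF NC q(1), of t "y n"] bq by linarith
    with up show ?thesis unfolding abs_le_iff by linarith
  qed
  have "norm (sup_conv b (N + n) t (y n) - b t x) < e" if "max n1 n2 \<le> n" for n
  proof -
    have "\<bar>sup_conv b (N + n) t (y n) - b t x\<bar> \<le> e / 2" by (rule close[OF that])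
    also have "\<dots> < e" using e by simp
    finally show ?thesis by simp
  qed
  then show "\<exists>no. \<forall>n\<ge>no. norm (sup_conv b (N + n) t (y n) - b t x) < e" by blast
qed

end

text \<open>The offset \<open>nat \<lceil>C\<rceil>\<close> keeps every index in the range
  \<open>C \<le> real n\<close>, where the envelopes are finite.\<close>

definition maximal_solution :: "(real \<Rightarrow> real \<Rightarrow> real) \<Rightarrow> real \<Rightarrow> (real \<Rightarrow> real) \<Rightarrow> real \<Rightarrow> real" where
  "maximal_solution b C r t = lim (\<lambda>n. picard_limit (sup_conv b (nat \<lceil>C\<rceil> + n)) r t)"

text \<open>The approximate solutions decrease, are bounded below, and differ from \<open>r\<close>
  by paths with a common Lipschitz constant, which the limit inherits. That part needs no continuity
  of \<open>b\<close>, so it can be used to establish the continuity premise of the third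
  claim.\<close>

lemma maximal_solution:
  fixes b :: "real \<Rightarrow> real \<Rightarrow> real"
  assumes b: "case_prod b \<in> borel_measurable (borel \<Otimes>\<^sub>M borel)"
    and growth: "\<And>t x. \<bar>b t x\<bar> \<le> C * (1 + \<bar>x\<bar>)"
    and r: "continuous_on {0..T} r" and T: "0 \<le> T"
  shows "t \<in> {0..T} \<Longrightarrow> (\<lambda>n. picard_limit (sup_conv b (nat \<lceil>C\<rceil> + n)) r t) \<longlonglongrightarrow> maximal_solution b C r t"
    and "\<exists>K. K-lipschitz_on {0..T} (\<lambda>t. maximal_solution b C r t - r t)"
    and "AE s in lborel. s \<in> {0..T} \<longrightarrow> isCont (b s) (maximal_solution b C r s) \<Longrightarrow> t \<in> {0..T} \<Longrightarrow>
      set_integrable lborel {0..t} (\<lambda>s. b s (maximal_solution b C r s)) \<and>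
      maximal_solution b C r t = r t + (LINT s:{0..t}|lborel. b s (maximal_solution b C r s))"
proof -
  define N where "N = nat \<lceil>C\<rceil>"
  define g where "g = (\<lambda>n. sup_conv b (N + n))"
  define y where "y n = picard_limit (g n) r" for n
  let ?x = "maximal_solution b C r"
  have C0: "0 \<le> C" by (rule growth_const_nonneg[OF growth])
  have N: "C \<le> real N" unfolding N_def by linarith
  then have Nn: "C \<le> real (N + n)" for n by simp
  have gm: "case_prod (g n) \<in> borel_measurable (borel \<Otimes>\<^sub>M borel)" for n
    unfolding g_def by (rule borel_measurable_sup_conv[OF growth b Nn])
  have gg: "\<bar>g n s x\<bar> \<le> C * (1 + \<bar>x\<bar>)" for n s x
    unfolding g_def by (rule sup_conv_abs_le[OF growth Nn])
  have gl: "\<bar>g n s x - g n s x'\<bar> \<le> real (N + n) * \<bar>x - x'\<bar>" for n s x x'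
    unfolding g_def by (rule sup_conv_lipschitz[OF growth Nn])
  note Y = picard_limit[OF gm gg gl r T, folded y_def]
  \<comment> \<open>A barrier: the lowest drift that the growth bound permits. It is itself
    Lipschitz, and its solution \<open>l\<close> bounds all \<open>y n\<close> from below
    independently of \<open>n\<close>.\<close>
  define h where "h = (\<lambda>(s::real) (x::real). - (C * (1 + \<bar>x\<bar>)))"
  define l where "l = picard_limit h r"
  have hm: "case_prod h \<in> borel_measurable (borel \<Otimes>\<^sub>M borel)"
    unfolding h_def split_beta' by measurable
  have hg: "\<bar>h s x\<bar> \<le> C * (1 + \<bar>x\<bar>)" for s x using C0 by (simp add: h_def abs_mult)
  have hl: "\<bar>h s x - h s x'\<bar> \<le> C * \<bar>x - x'\<bar>" for s x x'
  proof -
    have "\<bar>h s x - h s x'\<bar> = C * \<bar>\<bar>x'\<bar> - \<bar>x\<bar>\<bar>"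
      using C0 by (simp add: h_def abs_mult flip: right_diff_distrib)
    also have "\<dots> \<le> C * \<bar>x - x'\<bar>" using C0 by (intro mult_left_mono) auto
    finally show ?thesis .
  qed
  note l = picard_limit[OF hm hg hl r T, folded l_def]
  have TT: "T \<in> {0..T}" using T by simp
  \<comment> \<open>Here the larger drift \<open>g n\<close> supplies the Lipschitz constant; in the
    comparison with the barrier below it is the smaller drift \<open>h\<close>.\<close>
  have decr: "y (Suc n) t \<le> y n t" if "t \<in> {0..T}" for n t
  proof (rule solutions_le[where g = "g (Suc n)" and h = "g n" and L = "real (N + n)"
        and X = "y (Suc n)" and Y = "y n", OF Y(3) Y(3) Y(2)[OF TT] Y(2)[OF TT] _ _ that])
    show "g (Suc n) s x - g n s z \<le> real (N + n) * (x - z)" if "z < x" for s x z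
    proof -
      have "g (Suc n) s x \<le> g n s x"
        unfolding g_def by (rule sup_conv_antimono[OF growth Nn]) simp
      moreover have "\<bar>g n s x - g n s z\<bar> \<le> real (N + n) * (x - z)" using gl[of n s x z] that by simp
      ultimately show ?thesis by linarith
    qed
  qed simp_all
  have lower: "l t \<le> y n t" if "t \<in> {0..T}" for n t
  proof (rule solutions_le[where g = h and h = "g n" and X = l and Y = "y n",
        OF l(3) Y(3) l(2)[OF TT] Y(2)[OF TT] _ C0 that])
    show "h s x - g n s z \<le> C * (x - z)" if "z < x" for s x z
    proof -
      have "- g n s z \<le> C * (1 + \<bar>z\<bar>)" using gg[of n s z] by simp
      moreover have "C * \<bar>z\<bar> \<le> C * (\<bar>x\<bar> + (x - z))"
        using C0 that by (intro mult_left_mono) auto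
      ultimately show ?thesis by (simp add: h_def algebra_simps)
    qed
  qed
  obtain B1 where B1: "\<And>s. s \<in> {0..T} \<Longrightarrow> \<bar>l s\<bar> \<le> B1" using continuous_on_Icc_abs_le[OF l(1)] by blast
  obtain B2 where B2: "\<And>s. s \<in> {0..T} \<Longrightarrow> \<bar>y 0 s\<bar> \<le> B2" using continuous_on_Icc_abs_le[OF Y(1)] by blast
  have dec: "decseq (\<lambda>n. y n t)" if "t \<in> {0..T}" for t
    by (intro decseq_SucI decr that)
  define B where "B = max B1 B2"
  have yB: "\<bar>y n t\<bar> \<le> B" if "t \<in> {0..T}" for n t
    using lower[OF that, of n] decseqD[OF dec[OF that], of 0 n] B1[OF that] B2[OF that]
    unfolding B_def by simp
  have B0: "0 \<le> B" using yB[OF TT, of 0] by simp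
  have lim: "(\<lambda>n. y n t) \<longlonglongrightarrow> ?x t" if t: "t \<in> {0..T}" for t
  proof -
    have "convergent (\<lambda>n. y n t)"
      using decseq_convergent[OF dec[OF t], of "l t"] lower[OF t] convergentI by metis
    then show ?thesis
      by (simp add: convergent_LIMSEQ_iff maximal_solution_def y_def g_def N_def)
  qed
  show "t \<in> {0..T} \<Longrightarrow> (\<lambda>n. picard_limit (sup_conv b (nat \<lceil>C\<rceil> + n)) r t) \<longlonglongrightarrow> ?x t"
    using lim[of t] by (simp add: y_def g_def N_def)
  \<comment> \<open>Independent of \<open>n\<close>: although the Lipschitz constants of
    \<open>g n\<close> blow up, the growth constant \<open>C\<close> and the bound \<open>B\<close>
    are common to all. \<open>K\<close> is also the dominating constant below.\<close>
  define K where "K = C * (1 + B)"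
  have K0: "0 \<le> K" using C0 B0 by (simp add: K_def)
  have gK: "\<bar>g n s (y n s)\<bar> \<le> K" if "s \<in> {0..T}" for n s
    unfolding K_def using C0 yB[OF that, of n]
    by (intro order_trans[OF gg] mult_left_mono) auto
  have lipy: "\<bar>(y n t - r t) - (y n s - r s)\<bar> \<le> K * (t - s)" if st: "0 \<le> s" "s \<le> t" "t \<le> T" for n s t
  proof -
    have "(y n t - r t) - (y n s - r s) = (LINT u:{s<..t}|lborel. g n u (y n u))"
      using Y(3)[of t n] Y(3)[of s n] set_integral_split[OF Y(2)[of t n] st(1,2)] st by simp
    moreover have "\<bar>LINT u:{s<..t}|lborel. g n u (y n u)\<bar> \<le> (LINT u:{s<..t}|lborel. K)"
    proof (rule abs_set_integral_le)
      show "set_integrable lborel {s<..t} (\<lambda>u. g n u (y n u))"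
        by (rule set_integrable_subset[OF Y(2)[of t n]]) (use st in auto)
      show "set_integrable lborel {s<..t} (\<lambda>u. K)"
        by (rule set_integrable_subset[of _ "{s..t}"]) (auto intro: borel_integrable_atLeastAtMost')
    qed (use st gK in auto)
    moreover have "(LINT u:{s<..t}|lborel. K) = K * (t - s)"
      using st by (simp add: set_lebesgue_integral_def)
    ultimately show ?thesis by simp
  qed
  have lipx: "\<bar>(?x t - r t) - (?x s - r s)\<bar> \<le> K * (t - s)" if st: "0 \<le> s" "s \<le> t" "t \<le> T" for s t
  proof (rule LIMSEQ_le_const2)
    show "(\<lambda>n. \<bar>(y n t - r t) - (y n s - r s)\<bar>) \<longlonglongrightarrow> \<bar>(?x t - r t) - (?x s - r s)\<bar>"
      using st by (intro tendsto_intros lim) auto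
  qed (use lipy[OF st] in auto)
  have lip: "K-lipschitz_on {0..T} (\<lambda>t. ?x t - r t)"
  proof (rule lipschitz_onI[OF _ K0])
    fix t s assume "t \<in> {0..T}" "s \<in> {0..T}"
    then show "dist (?x t - r t) (?x s - r s) \<le> K * dist t s"
      using lipx[of s t] lipx[of t s] unfolding dist_real_def by (cases "s \<le> t") auto
  qed
  then show "\<exists>K. K-lipschitz_on {0..T} (\<lambda>t. ?x t - r t)" by blast
  have contx: "continuous_on {0..T} ?x"
    using continuous_on_add[OF lipschitz_on_continuous_on[OF lip] r] by simp
  assume ae: "AE s in lborel. s \<in> {0..T} \<longrightarrow> isCont (b s) (?x s)" and t: "t \<in> {0..T}"
  have ct: "continuous_on {0..t} ?x" "\<And>n. continuous_on {0..t} (y n)"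
    using t by (auto intro: continuous_on_subset[OF contx] continuous_on_subset[OF Y(1)])
  have "(\<lambda>n. LINT s:{0..t}|lborel. g n s (y n s)) \<longlonglongrightarrow> (LINT s:{0..t}|lborel. b s (?x s))"
    unfolding set_lebesgue_integral_def
  proof (rule integral_dominated_convergence)
    show "(\<lambda>s. indicator {0..t} s *\<^sub>R b s (?x s)) \<in> borel_measurable lborel"
      using set_borel_measurable_path[OF b ct(1)] by (simp add: set_borel_measurable_def)
    show "(\<lambda>s. indicator {0..t} s *\<^sub>R g n s (y n s)) \<in> borel_measurable lborel" for n
      using set_borel_measurable_path[OF gm ct(2)] by (simp add: set_borel_measurable_def)
    show "integrable lborel (\<lambda>s. indicator {0..t} s * K)" by (rule integrable_indicator_Icc)
    show "AE s in lborel. (\<lambda>n. indicator {0..t} s *\<^sub>R g n s (y n s)) \<longlonglongrightarrow> indicator {0..t} s *\<^sub>R b s (?x s)"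
      using ae
    proof eventually_elim
      case (elim s)
      show ?case
      proof (cases "s \<in> {0..t}")
        case True
        then have s: "s \<in> {0..T}" using t by simp
        have "(\<lambda>n. g n s (y n s)) \<longlonglongrightarrow> b s (?x s)"
          unfolding g_def using elim s by (intro sup_conv_tendsto[OF growth _ lim N]) auto
        then show ?thesis by (intro tendsto_scaleR tendsto_const)
      qed simp
    qed
    show "AE s in lborel. norm (indicator {0..t} s *\<^sub>R g n s (y n s)) \<le> indicator {0..t} s * K" for n
      using gK t by (intro AE_I2) (auto simp: indicator_def)
  qed
  from tendsto_add[OF tendsto_const[of "r t"] this]
  have "(\<lambda>n. y n t) \<longlonglongrightarrow> r t + (LINT s:{0..t}|lborel. b s (?x s))" using Y(3)[OF t] by simp
  with lim[OF t] have "?x t = r t + (LINT s:{0..t}|lborel. b s (?x s))" by (rule LIMSEQ_unique)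
  moreover have "set_integrable lborel {0..t} (\<lambda>s. b s (?x s))"
    by (rule set_integrable_path[OF b growth ct(1)])
  ultimately show "set_integrable lborel {0..t} (\<lambda>s. b s (?x s)) \<and>
      ?x t = r t + (LINT s:{0..t}|lborel. b s (?x s))" by blast
qed

section \<open>The small ball estimate for the Riemann--Liouville process\<close>

text \<open>An Esseen-type inequality. As \<open>exp (- y\<^sup>2 / 2)\<close> is the characteristic
  function of the standard normal law, Fubini turns the mean of
  \<open>exp (- (Y \<omega> / r)\<^sup>2 / 2)\<close> into a Gaussian average of the characteristic
  function of \<open>Y\<close> at \<open>u / r\<close>. A bound on its modulus is enough;
  \<open>Y\<close> itself may have any law.\<close>

lemma (in prob_space) prob_small_ball_le:
  fixes Y :: "'a \<Rightarrow> real"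
  assumes Y[measurable]: "Y \<in> borel_measurable M" and \<sigma>: "0 < \<sigma>" and r: "0 < r"
    and bound: "\<And>u. norm (char (distr M borel Y) u) \<le> exp (- (\<sigma>\<^sup>2 * u\<^sup>2) / 2)"
  shows "prob {\<omega> \<in> space M. \<bar>Y \<omega>\<bar> \<le> r} \<le> 2 * r / \<sigma>"
proof -
  interpret N: prob_space std_normal_distribution
    by (rule prob_space_normal_density) simp
  interpret PP: pair_prob_space M std_normal_distribution ..
  let ?e = "\<lambda>\<omega> u. iexp (Y \<omega> / r * u)"
  have int: "integrable (M \<Otimes>\<^sub>M std_normal_distribution) (case_prod ?e)"
    by (rule PP.P.integrable_const_bound[where B = 1]) (auto simp: split_beta')
  have "complex_of_real ((LINT \<omega>|M. exp (- (Y \<omega> / r)\<^sup>2 / 2)))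
      = (CLINT \<omega>|M. char std_normal_distribution (Y \<omega> / r))"
    by (simp add: char_std_normal_distribution)
  also have "\<dots> = (CLINT \<omega>|M. CLINT u|std_normal_distribution. ?e \<omega> u)"
    by (simp add: char_def)
  also have "\<dots> = (CLINT u|std_normal_distribution. CLINT \<omega>|M. ?e \<omega> u)"
    using PP.Fubini_integral[OF int] by simp
  also have "\<dots> = (CLINT u|std_normal_distribution. char (distr M borel Y) (u / r))"
    by (simp add: char_def integral_distr mult_ac)
  finally have "norm (complex_of_real (LINT \<omega>|M. exp (- (Y \<omega> / r)\<^sup>2 / 2)))
      = norm (CLINT u|std_normal_distribution. char (distr M borel Y) (u / r))"
    by (rule arg_cong)
  then have "(LINT \<omega>|M. exp (- (Y \<omega> / r)\<^sup>2 / 2))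
      = norm (CLINT u|std_normal_distribution. char (distr M borel Y) (u / r))"
    by (simp add: abs_of_nonneg[OF integral_nonneg])
  also have "\<dots> \<le> (LINT u|std_normal_distribution. exp (- (\<sigma> * u / r)\<^sup>2 / 2))"
  proof (rule order_trans[OF integral_norm_bound integral_mono])
    interpret D: real_distribution "distr M borel Y" by (simp add: real_distribution_distr)
    have cm: "char (distr M borel Y) \<in> borel_measurable borel" by (rule D.char_measurable)
    show "integrable std_normal_distribution (\<lambda>u. norm (char (distr M borel Y) (u / r)))"
      by (rule N.integrable_const_bound[where B = 1])
        (auto simp: D.cmod_char_le_1 intro!: measurable_compose[OF _ cm])
    show "integrable std_normal_distribution (\<lambda>u. exp (- (\<sigma> * u / r)\<^sup>2 / 2))"
      by (rule N.integrable_const_bound[where B = 1]) auto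
    show "norm (char (distr M borel Y) (u / r)) \<le> exp (- (\<sigma> * u / r)\<^sup>2 / 2)" for u
      using bound[of "u / r"] by (simp add: power_mult_distrib power_divide)
  qed
  also have "\<dots> = (LINT u|lborel. std_normal_density u * exp (- (\<sigma> * u / r)\<^sup>2 / 2))"
    by (subst integral_density) (auto simp: normal_density_nonneg)
  \<comment> \<open>The standard density is bounded by its maximum \<open>1 / sqrt (2 * pi)\<close>;
    what remains is \<open>r / \<sigma>\<close> times a normal density, of total mass 1.\<close>
  also have "\<dots> \<le> (LINT u|lborel. r / \<sigma> * normal_density 0 (r / \<sigma>) u)"
  proof (rule integral_mono)
    show "integrable lborel (\<lambda>u. r / \<sigma> * normal_density 0 (r / \<sigma>) u)"
      using r \<sigma> by (intro integrable_mult_right integrable_normal_density) simp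
    show "integrable lborel (\<lambda>u. std_normal_density u * exp (- (\<sigma> * u / r)\<^sup>2 / 2))"
      by (rule Bochner_Integration.integrable_bound[OF integrable_normal_density[of 1 0]])
         (auto simp: normal_density_nonneg mult_le_cancel_left1 intro!: mult_left_le)
    fix u :: real
    have "std_normal_density u \<le> 1 / sqrt (2 * pi)"
      unfolding std_normal_density_def by (intro mult_left_le) auto
    then have "std_normal_density u * exp (- (\<sigma> * u / r)\<^sup>2 / 2)
      \<le> 1 / sqrt (2 * pi) * exp (- (\<sigma> * u / r)\<^sup>2 / 2)"
      by (intro mult_right_mono) auto
    also have "\<dots> = r / \<sigma> * normal_density 0 (r / \<sigma>) u"
    proof -
      have "sqrt (2 * pi * (r / \<sigma>)\<^sup>2) = sqrt (2 * pi) * (r / \<sigma>)"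
        using r \<sigma> by (simp add: real_sqrt_mult)
      moreover have "- (u - 0)\<^sup>2 / (2 * (r / \<sigma>)\<^sup>2) = - (\<sigma> * u / r)\<^sup>2 / 2"
        using r \<sigma> by (simp add: power_divide power_mult_distrib mult_ac)
      ultimately show ?thesis
        unfolding normal_density_def using r \<sigma> by simp
    qed
    finally show "std_normal_density u * exp (- (\<sigma> * u / r)\<^sup>2 / 2) \<le> \<dots>" .
  qed
  also have "\<dots> = r / \<sigma>" using r \<sigma> by simp
  finally have E: "(LINT \<omega>|M. exp (- (Y \<omega> / r)\<^sup>2 / 2)) \<le> r / \<sigma>" .
  have "prob {\<omega> \<in> space M. \<bar>Y \<omega>\<bar> \<le> r}
      = integral\<^sup>L M (indicator {\<omega> \<in> space M. \<bar>Y \<omega>\<bar> \<le> r})"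
    by simp
  also have "\<dots> \<le> (LINT \<omega>|M. 2 * exp (- (Y \<omega> / r)\<^sup>2 / 2))"
  proof (rule integral_mono)
    show "integrable M (\<lambda>\<omega>. 2 * exp (- (Y \<omega> / r)\<^sup>2 / 2))"
      by (rule integrable_const_bound[where B = 2]) auto
    fix \<omega>
    show "indicator {\<omega> \<in> space M. \<bar>Y \<omega>\<bar> \<le> r} \<omega> \<le> 2 * exp (- (Y \<omega> / r)\<^sup>2 / 2)"
    proof (cases "\<bar>Y \<omega>\<bar> \<le> r")
      case True
      then have "(Y \<omega> / r)\<^sup>2 \<le> 1" using r by (simp add: abs_square_le_1)
      \<comment> \<open>The factor 2 is the reciprocal of \<open>1 - 1 / 2\<close>, a lower bound
        for \<open>exp (- z / 2)\<close> when \<open>z \<le> 1\<close>.\<close>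
      then have "1 \<le> 2 * (1 + - (Y \<omega> / r)\<^sup>2 / 2)" by simp
      also have "\<dots> \<le> 2 * exp (- (Y \<omega> / r)\<^sup>2 / 2)"
        by (intro mult_left_mono exp_ge_add_one_self) simp
      finally have "1 \<le> 2 * exp (- (Y \<omega> / r)\<^sup>2 / 2)" .
      then show ?thesis by (simp add: indicator_def)
    qed (simp add: indicator_def)
  qed (auto simp: integrable_indicator_iff emeasure_eq_measure)
  also have "\<dots> = 2 * (LINT \<omega>|M. exp (- (Y \<omega> / r)\<^sup>2 / 2))" by simp
  finally show ?thesis using E by simp
qed

lemma (in prob_space) char_normal:
  assumes "distributed M lborel X (normal_density 0 \<sigma>)" "0 < \<sigma>"
  shows "char (distr M borel X) u = exp (- (\<sigma>\<^sup>2 * u\<^sup>2) / 2)"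
proof -
  have [measurable]: "X \<in> borel_measurable M"
    using distributed_measurable[OF assms(1)] by simp
  have d: "distributed M lborel (\<lambda>x. X x / \<sigma>) std_normal_density"
    using normal_standard_normal_convert[of \<sigma> X 0] assms by simp
  have "distr M borel (\<lambda>x. X x / \<sigma>) = distr M lborel (\<lambda>x. X x / \<sigma>)"
    by (rule distr_cong) auto
  also have "\<dots> = std_normal_distribution"
    using distributed_distr_eq_density[OF d] .
  finally have "char (distr M borel (\<lambda>x. X x / \<sigma>)) (\<sigma> * u) = exp (- (\<sigma> * u)\<^sup>2 / 2)"
    by (simp add: char_std_normal_distribution)
  moreover have "char (distr M borel (\<lambda>x. X x / \<sigma>)) (\<sigma> * u) = char (distr M borel X) u"
    using assms(2) by (simp add: char_def integral_distr)
  ultimately show ?thesis by (simp add: power_mult_distrib)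
qed

section \<open>Measurability with respect to the augmented filtration\<close>

lemma space_augmented_filtration [simp]: "space (augmented_filtration M W t) = space M"
  unfolding augmented_filtration_def by (rule space_measure_of[OF augmented_filtration_gen])

lemma sets_augmented_filtration:
  "sets (augmented_filtration M W t) = sigma_sets (space M)
     ({W s -` B \<inter> space M | s B. s \<in> {0..t} \<and> B \<in> sets borel} \<union> null_sets M)"
  unfolding augmented_filtration_def by (rule sets_measure_of[OF augmented_filtration_gen])

lemma null_sets_augmented_filtration: "N \<in> null_sets M \<Longrightarrow> N \<in> sets (augmented_filtration M W t)"
  unfolding sets_augmented_filtration by (auto intro: sigma_sets.Basic)

lemma measurable_augmented_filtration:
  assumes "s \<in> {0..t}"
  shows "W s \<in> borel_measurable (augmented_filtration M W t)"
  using assms by (intro measurableI) (auto simp: sets_augmented_filtration intro!: sigma_sets.Basic)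

lemma augmented_filtration_mono:
  assumes "f \<in> borel_measurable (augmented_filtration M W s)" "s \<le> t"
  shows "f \<in> borel_measurable (augmented_filtration M W t)"
  using filtration.sets_F_mono[OF filtration_augmented_filtration assms(2)]
  by (intro measurable_from_subalg[OF _ assms(1)]) (auto simp: subalgebra_def)

lemma augmented_filtration_subset_events:
  assumes "standard_brownian_motion M T W" "t \<le> T"
  shows "sets (augmented_filtration M W t) \<subseteq> sets M"
  unfolding sets_augmented_filtration
proof (rule sets.sigma_sets_subset)
  have "W s -` B \<inter> space M \<in> sets M" if "s \<in> {0..t}" "B \<in> sets borel" for s B
    using that assms by (intro measurable_sets[of "W s" M borel]) (auto simp: standard_brownian_motion_def)
  then show "{W s -` B \<inter> space M | s B. s \<in> {0..t} \<and> B \<in> sets borel} \<union> null_sets M \<subseteq> sets M"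
    by auto
qed

lemma augmented_filtration_measurable_imp:
  assumes "standard_brownian_motion M T W" "t \<le> T" "f \<in> borel_measurable (augmented_filtration M W t)"
  shows "f \<in> borel_measurable M"
  using augmented_filtration_subset_events[OF assms(1,2)]
  by (intro measurable_from_subalg[OF _ assms(3)]) (auto simp: subalgebra_def)

text \<open>On the exceptional null set, a preimage under \<open>g\<close> is an event of
  \<open>M\<close> inside a null set, hence null and a member of the augmented filtration at every
  time. So changing an adapted process to a better version keeps it adapted.\<close>

lemma augmented_filtration_AE_eq:
  fixes f g :: "'a \<Rightarrow> real"
  assumes f: "f \<in> borel_measurable (augmented_filtration M W t)" and g: "g \<in> borel_measurable M"
    and eq: "AE \<omega> in M. f \<omega> = g \<omega>"
  shows "g \<in> borel_measurable (augmented_filtration M W t)"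
proof (rule measurableI)
  fix B :: "real set" assume B: "B \<in> sets borel"
  obtain N where N: "N \<in> null_sets M" "{\<omega> \<in> space M. f \<omega> \<noteq> g \<omega>} \<subseteq> N"
    using eq by (auto elim!: AE_E simp: null_sets_def)
  have "g -` B \<inter> space M = (f -` B \<inter> space M - N) \<union> (g -` B \<inter> space M \<inter> N)"
    using N(2) by auto
  moreover have "g -` B \<inter> space M \<inter> N \<in> sets (augmented_filtration M W t)"
    using measurable_sets[OF g B] N(1)
    by (intro null_sets_augmented_filtration null_set_Int1[of N]) (auto simp: Int_commute intro: null_set_Int1)
  moreover have "f -` B \<inter> space M \<in> sets (augmented_filtration M W t)"
    using measurable_sets[OF f B] by simp
  ultimately show "g -` B \<inter> space (augmented_filtration M W t) \<in> sets (augmented_filtration M W t)"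
    using null_sets_augmented_filtration[OF N(1), of W t]
    by (metis sets.Diff sets.Un space_augmented_filtration)
qed simp

text \<open>The increment is independent of everything known at time \<open>s\<close>, so the
  characteristic function factorizes, and the Gaussian factor is a positive real.\<close>

lemma (in prob_space) char_add_increment:
  assumes W: "standard_brownian_motion M T W"
    and st: "0 \<le> s" "s \<le> t" "t \<le> T"
    and Z: "Z \<in> borel_measurable (augmented_filtration M W s)"
  shows "norm (char (distr M borel (\<lambda>\<omega>. Z \<omega> + c * (W t \<omega> - W s \<omega>))) u)
     = norm (char (distr M borel Z) u) * exp (- (c\<^sup>2 * (t - s) * u\<^sup>2) / 2)"
proof (cases "s = t")
  case False
  let ?D = "\<lambda>\<omega>. W t \<omega> - W s \<omega>"
  have "s < t" using False st by simp
  with W st have dist: "distributed M lborel ?D (normal_density 0 (sqrt (t - s)))"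
    and indep: "indep_set (sets (augmented_filtration M W s)) (sets (vimage_algebra (space M) ?D borel))"
    and [measurable]: "W t \<in> borel_measurable M" "W s \<in> borel_measurable M"
    by (auto simp: standard_brownian_motion_def)
  have Zm[measurable]: "Z \<in> borel_measurable M"
    using augmented_filtration_measurable_imp[OF W _ Z] st by simp
  have "indep_set (sigma_sets (space M) {Z -` A \<inter> space M |A. A \<in> sets borel})
        (sigma_sets (space M) {?D -` A \<inter> space M |A. A \<in> sets borel})"
  proof -
    have "sigma_sets (space M) {Z -` A \<inter> space M |A. A \<in> sets borel} \<subseteq> sets (augmented_filtration M W s)"
      using measurable_sets[OF Z] 
      by (intro sets.sigma_sets_subset[where M = "augmented_filtration M W s", simplified]) auto
    moreover have "sigma_sets (space M) {?D -` A \<inter> space M |A. A \<in> sets borel} = sets (vimage_algebra (space M) ?D borel)"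
      by (simp add: sets_vimage_algebra)
    ultimately show ?thesis using indep unfolding indep_sets2_eq by auto
  qed
  then have "indep_var borel Z borel ?D"
    unfolding indep_var_eq by simp
  from indep_var_compose[OF this, of "\<lambda>x. x" borel "\<lambda>x. c * x" borel]
  have "indep_var borel Z borel (\<lambda>\<omega>. c * ?D \<omega>)" by (simp add: comp_def)
  from char_distr_add[OF this]
  have "char (distr M borel (\<lambda>\<omega>. Z \<omega> + c * ?D \<omega>)) u
    = char (distr M borel Z) u * char (distr M borel (\<lambda>\<omega>. c * ?D \<omega>)) u" .
  also have "char (distr M borel (\<lambda>\<omega>. c * ?D \<omega>)) u = char (distr M borel ?D) (c * u)"
    by (simp add: char_def integral_distr mult_ac)
  also have "\<dots> = exp (- ((sqrt (t - s))\<^sup>2 * (c * u)\<^sup>2) / 2)"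
    using \<open>s < t\<close> by (intro char_normal dist) simp
  finally show ?thesis using \<open>s < t\<close> by (simp add: norm_mult power_mult_distrib mult_ac)
qed simp

section \<open>Elementary integrals and the energy of the kernel\<close>

lemma measurable_step_integral:
  assumes "\<And>i. i \<le> n \<Longrightarrow> p i \<in> {0..t}"
  shows "step_integral W n c p \<in> borel_measurable (augmented_filtration M W t)"
  unfolding step_integral_def
  using assms by (intro borel_measurable_sum borel_measurable_times borel_measurable_diff
    measurable_augmented_filtration borel_measurable_const) auto

text \<open>Removing the increments from the last to the first yields one Gaussian factor each; what
  is left is \<open>Z\<close>, whose characteristic function has modulus at most 1. The sum in the
  exponent is the variance of the step integral, so information from before \<open>p 0\<close>
  cannot spoil the decay.\<close>

lemma (in prob_space) char_add_step_integral_le: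
  assumes W: "standard_brownian_motion M T W"
    and p: "mono_on {..n} p" "0 \<le> p 0" "p n \<le> T"
    and Z: "Z \<in> borel_measurable (augmented_filtration M W (p 0))"
  shows "norm (char (distr M borel (\<lambda>\<omega>. Z \<omega> + step_integral W n c p \<omega>)) u)
     \<le> exp (- ((\<Sum>i<n. (c i)\<^sup>2 * (p (Suc i) - p i)) * u\<^sup>2) / 2)"
  using p
proof (induction n)
  case 0
  have "Z \<in> borel_measurable M"
    using augmented_filtration_measurable_imp[OF W _ Z] 0 by simp
  then interpret D: real_distribution "distr M borel Z" by (simp add: real_distribution_distr)
  show ?case using D.cmod_char_le_1[of u] by (simp add: step_integral_def)
next
  case (Suc n)
  have p: "p i \<le> p j" if "i \<le> j" "j \<le> Suc n" for i j
    using Suc.prems(1) that by (auto simp: mono_on_def)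
  let ?Z = "\<lambda>\<omega>. Z \<omega> + step_integral W n c p \<omega>"
  have "?Z \<in> borel_measurable (augmented_filtration M W (p n))"
    using p Suc.prems(2) p[of 0]
    by (intro borel_measurable_add measurable_step_integral augmented_filtration_mono[OF Z])
       (auto intro: order_trans[of 0 "p 0"])
  from char_add_increment[OF W _ _ _ this, of "p (Suc n)" "c n" u] p[of n "Suc n"] p[of 0 n] Suc.prems
  have "norm (char (distr M borel (\<lambda>\<omega>. Z \<omega> + step_integral W (Suc n) c p \<omega>)) u)
    = norm (char (distr M borel ?Z) u) * exp (- ((c n)\<^sup>2 * (p (Suc n) - p n) * u\<^sup>2) / 2)"
    by (simp add: step_integral_def add.assoc)
  also have "\<dots> \<le> exp (- ((\<Sum>i<n. (c i)\<^sup>2 * (p (Suc i) - p i)) * u\<^sup>2) / 2) * exp (- ((c n)\<^sup>2 * (p (Suc n) - p n) * u\<^sup>2) / 2)"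
    using Suc.prems order_trans[OF p[of n "Suc n"] Suc.prems(3)]
    by (intro mult_right_mono Suc.IH) (auto simp: mono_on_def)
  also have "\<dots> = exp (- ((\<Sum>i<Suc n. (c i)\<^sup>2 * (p (Suc i) - p i)) * u\<^sup>2) / 2)"
    unfolding exp_add[symmetric] sum.lessThan_Suc distrib_right minus_add_distrib add_divide_distrib ..
  finally show ?case .
qed

text \<open>The half-open intervals of a monotone partition are disjoint, so the cross terms
  vanish.\<close>

lemma step_fun_power2:
  assumes "mono_on {..n} p"
  shows "(step_fun n c p x)\<^sup>2 = (\<Sum>i<n. (c i)\<^sup>2 * indicator {p i<..p (Suc i)} x)"
  using assms
proof (induction n)
  case 0
  then show ?case by (simp add: step_fun_def)
next
  case (Suc n)
  have "step_fun n c p x * indicator {p n<..p (Suc n)} x = 0"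
  proof (cases "p n < x")
    case True
    have "indicator {p i<..p (Suc i)} x = (0::real)" if "i < n" for i
      using True that mono_onD[OF Suc.prems, of "Suc i" n] by (auto simp: indicator_def)
    then show ?thesis by (simp add: step_fun_def)
  qed simp
  then have "(step_fun (Suc n) c p x)\<^sup>2
      = (step_fun n c p x)\<^sup>2 + (c n)\<^sup>2 * indicator {p n<..p (Suc n)} x"
    by (auto simp: step_fun_def power2_eq_square algebra_simps indicator_def)
  with Suc show ?case by (auto simp: mono_on_def)
qed

text \<open>Truncating the partition points from above and from below at \<open>s\<close> keeps the
  coefficients; an interval on the wrong side collapses and contributes 0. This separates past and
  future of \<open>s\<close> without inserting \<open>s\<close> into the partition.\<close>

lemma step_integral_split:
  "step_integral W n c p \<omega>
    = step_integral W n c (\<lambda>i. min s (p i)) \<omega> + step_integral W n c (\<lambda>i. max s (p i)) \<omega>"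
proof -
  have "W (min s a) \<omega> + W (max s a) \<omega> = W s \<omega> + W a \<omega>" for a
    by (auto simp: min_def max_def)
  then have "W b \<omega> - W a \<omega> = (W (min s b) \<omega> - W (min s a) \<omega>) + (W (max s b) \<omega> - W (max s a) \<omega>)" for a b
    by (smt (verit))
  then show ?thesis
    unfolding step_integral_def sum.distrib[symmetric] by (intro sum.cong) (auto simp: algebra_simps)
qed

text \<open>One half of the Ito isometry for the part after \<open>s\<close>: the right-hand side is
  the variance of the truncated step integral, and a lower bound for it is what is wanted.\<close>

lemma nn_integral_step_fun_power2_le:
  assumes p: "mono_on {..n} p"
  shows "(\<integral>\<^sup>+x\<in>{s..t}. ennreal ((step_fun n c p x)\<^sup>2) \<partial>lborel)
    \<le> ennreal (\<Sum>i<n. (c i)\<^sup>2 * (max s (p (Suc i)) - max s (p i)))"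
proof -
  have le: "p i \<le> p (Suc i)" if "i < n" for i
    using that mono_onD[OF p, of i "Suc i"] by simp
  have "(\<integral>\<^sup>+x\<in>{s..t}. ennreal ((step_fun n c p x)\<^sup>2) \<partial>lborel)
    \<le> (\<integral>\<^sup>+x. (\<Sum>i<n. ennreal ((c i)\<^sup>2) * indicator {max s (p i)..max s (p (Suc i))} x) \<partial>lborel)"
  proof (rule nn_integral_mono)
    fix x
    have "ennreal ((step_fun n c p x)\<^sup>2) * indicator {s..t} x
      = (\<Sum>i<n. ennreal ((c i)\<^sup>2) * (indicator {p i<..p (Suc i)} x * indicator {s..t} x))"
      unfolding step_fun_power2[OF p]
      by (simp add: ennreal_mult ennreal_indicator sum_distrib_right mult.assoc
        del: sum_mult_indicator sum_indicator_mult flip: sum_ennreal)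
    also have "\<dots> \<le> (\<Sum>i<n. ennreal ((c i)\<^sup>2) * indicator {max s (p i)..max s (p (Suc i))} x)"
      by (intro sum_mono mult_left_mono) (auto simp: indicator_def)
    finally show "ennreal ((step_fun n c p x)\<^sup>2) * indicator {s..t} x \<le> \<dots>" .
  qed
  also have "\<dots> = (\<Sum>i<n. ennreal ((c i)\<^sup>2) * emeasure lborel {max s (p i)..max s (p (Suc i))})"
    by (subst nn_integral_sum) (auto simp: nn_integral_cmult)
  also have "\<dots> = (\<Sum>i<n. ennreal ((c i)\<^sup>2 * (max s (p (Suc i)) - max s (p i))))"
  proof (intro sum.cong refl)
    fix i assume "i \<in> {..<n}"
    then have "max s (p i) \<le> max s (p (Suc i))" using le[of i] by (auto simp: max_def)
    then show "ennreal ((c i)\<^sup>2) * emeasure lborel {max s (p i)..max s (p (Suc i))}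
      = ennreal ((c i)\<^sup>2 * (max s (p (Suc i)) - max s (p i)))"
      by (simp add: ennreal_mult del: max.bounded_iff)
  qed
  also have "\<dots> = ennreal (\<Sum>i<n. (c i)\<^sup>2 * (max s (p (Suc i)) - max s (p i)))"
    using le by (intro sum_ennreal mult_nonneg_nonneg) (auto simp: max_def intro: order_trans)
  finally show ?thesis .
qed

text \<open>The exact value is \<open>(t - s) powr (2 * H) / (2 * H)\<close>. The cruder constant
  comes from the left half of the interval alone, where \<open>t - x\<close> is comparable to
  \<open>t - s\<close>; this treats both signs of \<open>2 * H - 1\<close> and stays away from the
  singularity at \<open>t\<close>.\<close>

lemma nn_integral_kernel_ge:
  assumes H: "0 < H" "H < 1" and st: "s < t"
  shows "ennreal ((t - s) powr (2 * H) / 4)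
    \<le> (\<integral>\<^sup>+x\<in>{s..t}. ennreal (((t - x) powr (H - 1 / 2))\<^sup>2) \<partial>lborel)"
proof -
  define m where "m = (s + t) / 2"
  have pw: "(t - s) powr (2 * H - 1) / 2 \<le> ((t - x) powr (H - 1 / 2))\<^sup>2" if x: "x \<in> {s..m}" for x
  proof -
    have tx: "(t - s) / 2 \<le> t - x" "t - x \<le> t - s" "0 < t - x"
      using x st by (auto simp: m_def field_simps)
    have eq: "((t - x) powr (H - 1 / 2))\<^sup>2 = (t - x) powr (2 * H - 1)"
      by (simp add: power2_eq_square flip: powr_add)
    show ?thesis
    proof (cases "2 * H \<ge> 1")
      case True
      \<comment> \<open>The denominator is written as \<open>2 powr 1\<close> so that it can be
        lowered to \<open>2 powr (2 * H - 1)\<close>, by \<open>H < 1\<close>.\<close>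
      have "(t - s) powr (2 * H - 1) / 2 = (t - s) powr (2 * H - 1) / 2 powr 1" by simp
      also have "\<dots> \<le> (t - s) powr (2 * H - 1) / 2 powr (2 * H - 1)"
        using H by (intro divide_left_mono powr_mono) auto
      also have "\<dots> = ((t - s) / 2) powr (2 * H - 1)"
        using st by (simp add: powr_divide)
      also have "\<dots> \<le> (t - x) powr (2 * H - 1)"
        using True tx st by (intro powr_mono2) auto
      finally show ?thesis using eq by simp
    next
      case False
      have "(t - s) powr (2 * H - 1) / 2 \<le> (t - s) powr (2 * H - 1)" by simp
      also have "\<dots> \<le> (t - x) powr (2 * H - 1)"
        using False tx st by (intro powr_mono2') auto
      finally show ?thesis using eq by simp
    qed
  qed
  have "(t - s) powr (2 * H) = (t - s) powr (2 * H - 1) * (t - s)"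
    using st by (simp add: powr_diff)
  then have "ennreal ((t - s) powr (2 * H) / 4) = ennreal ((t - s) powr (2 * H - 1) / 2) * ennreal (m - s)"
    using st by (subst ennreal_mult[symmetric]) (auto simp: m_def field_simps)
  also have "\<dots> = (\<integral>\<^sup>+x\<in>{s..m}. ennreal ((t - s) powr (2 * H - 1) / 2) \<partial>lborel)"
    using st by (subst nn_integral_cmult_indicator) (auto simp: m_def)
  also have "\<dots> \<le> (\<integral>\<^sup>+x\<in>{s..t}. ennreal (((t - x) powr (H - 1 / 2))\<^sup>2) \<partial>lborel)"
    using pw st by (intro nn_integral_mono) (auto simp: indicator_def m_def ennreal_leI)
  finally show ?thesis .
qed

text \<open>Mean-square convergence is convergence of the squared errors in the mean, so a
  subsequence converges almost surely. The step functions along it still approximate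
  \<open>f\<close>, and one sequence serves both purposes.\<close>

lemma has_wiener_integral_AE:
  assumes W: "\<And>s. s \<in> {0..t} \<Longrightarrow> W s \<in> borel_measurable M"
    and I: "has_wiener_integral M W f t I"
  obtains n c p where
    "\<forall>k. mono_on {..n k} (p k) \<and> 0 \<le> p k 0 \<and> p k (n k) \<le> t"
    "(\<lambda>k. \<integral>\<^sup>+ s\<in>{0..t}. ennreal ((f s - step_fun (n k) (c k) (p k) s)\<^sup>2) \<partial>lborel) \<longlonglongrightarrow> 0"
    "AE \<omega> in M. (\<lambda>k. step_integral W (n k) (c k) (p k) \<omega>) \<longlonglongrightarrow> I \<omega>"
proof -
  have Im[measurable]: "I \<in> borel_measurable M"
    using I by (simp add: has_wiener_integral_def)
  obtain n c p where
    p': "\<forall>k. mono_on {..n k} (p k) \<and> 0 \<le> p k 0 \<and> p k (n k) \<le> t"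
    and \<delta>: "(\<lambda>k. \<integral>\<^sup>+ s\<in>{0..t}. ennreal ((f s - step_fun (n k) (c k) (p k) s)\<^sup>2) \<partial>lborel) \<longlonglongrightarrow> 0"
    and J: "(\<lambda>k. \<integral>\<^sup>+ \<omega>. ennreal ((I \<omega> - step_integral W (n k) (c k) (p k) \<omega>)\<^sup>2) \<partial>M) \<longlonglongrightarrow> 0"
    using I unfolding has_wiener_integral_def by blast
  have p: "mono_on {..n k} (p k)" "0 \<le> p k 0" "p k (n k) \<le> t" for k
    using p' by auto
  have pk: "p k i \<in> {0..t}" if "i \<le> n k" for k i
    using mono_onD[OF p(1), of 0 k i] mono_onD[OF p(1), of i k "n k"] that p(2,3)[of k] by simp
  have Jm[measurable]: "step_integral W (n k) (c k) (p k) \<in> borel_measurable M" for k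
    unfolding step_integral_def
    by (intro borel_measurable_sum borel_measurable_times borel_measurable_diff W borel_measurable_const pk) auto
  let ?D = "\<lambda>k \<omega>. (I \<omega> - step_integral W (n k) (c k) (p k) \<omega>)\<^sup>2"
  have "\<forall>\<^sub>F k in sequentially. (\<integral>\<^sup>+ \<omega>. ennreal (?D k \<omega>) \<partial>M) < 1"
    using order_tendstoD(2)[OF J, of 1] by simp
  \<comment> \<open>Second moments are known to be finite only from some index on; the shift by
    \<open>N\<close> provides the integrability that the subsequence theorem asks for.\<close>
  then obtain N where N: "\<forall>k. N \<le> k \<longrightarrow> (\<integral>\<^sup>+ \<omega>. ennreal (?D k \<omega>) \<partial>M) < 1"
    unfolding eventually_sequentially by blast
  have int: "integrable M (?D (k + N))" for k
  proof (rule integrableI_bounded)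
    show "(\<integral>\<^sup>+ \<omega>. ennreal (norm (?D (k + N) \<omega>)) \<partial>M) < \<infinity>"
      using order.strict_trans[OF N[rule_format, of "k + N"] ennreal_one_less_top] by simp
  qed measurable
  have "(\<lambda>k. enn2real (\<integral>\<^sup>+ \<omega>. ennreal (?D (k + N) \<omega>) \<partial>M)) \<longlonglongrightarrow> 0"
    using LIMSEQ_ignore_initial_segment[OF J, of N] by (intro tendsto_enn2real) simp_all
  then have "(\<lambda>k. \<integral>\<omega>. norm (?D (k + N) \<omega>) \<partial>M) \<longlonglongrightarrow> 0"
    by (simp add: integral_eq_nn_integral)
  from tendsto_L1_AE_subseq[OF int this] obtain r where r: "strict_mono r"
    and AE: "AE \<omega> in M. (\<lambda>k. ?D (r k + N) \<omega>) \<longlonglongrightarrow> 0"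
    by blast
  show ?thesis
  proof (rule that[of "\<lambda>k. n (r k + N)" "\<lambda>k. p (r k + N)" "\<lambda>k. c (r k + N)"])
    have "strict_mono (\<lambda>k. r k + N)" using r by (simp add: strict_mono_def)
    from LIMSEQ_subseq_LIMSEQ[OF \<delta> this]
    show "(\<lambda>k. \<integral>\<^sup>+ s\<in>{0..t}. ennreal ((f s - step_fun (n (r k + N)) (c (r k + N)) (p (r k + N)) s)\<^sup>2) \<partial>lborel) \<longlonglongrightarrow> 0"
      by (simp add: comp_def)
    show "AE \<omega> in M. (\<lambda>k. step_integral W (n (r k + N)) (c (r k + N)) (p (r k + N)) \<omega>) \<longlonglongrightarrow> I \<omega>"
      using AE
    proof eventually_elim
      case (elim \<omega>)
      from tendsto_real_sqrt[OF this]
      have "(\<lambda>k. \<bar>I \<omega> - step_integral W (n (r k + N)) (c (r k + N)) (p (r k + N)) \<omega>\<bar>) \<longlonglongrightarrow> 0"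
        by simp
      then show ?case
        by (subst (asm) tendsto_rabs_zero_iff) (drule tendsto_diff[OF tendsto_const[of "I \<omega>"]], simp)
    qed
  qed (use p in auto)
qed

text \<open>The step integrals over \<open>{0..t}\<close> use only \<open>W\<close> up to
  \<open>t\<close>, and so does their pointwise \<open>lim\<close>; it equals \<open>R t\<close> up
  to a null set.\<close>

lemma riemann_liouville_adapted:
  assumes W: "standard_brownian_motion M T W" and R: "riemann_liouville_process M T W H R"
    and t: "t \<in> {0..T}"
  shows "R t \<in> borel_measurable (augmented_filtration M W t)"
proof -
  have I: "has_wiener_integral M W (\<lambda>s. (t - s) powr (H - 1 / 2)) t (R t)"
    using R t by (simp add: riemann_liouville_process_def)
  have Wm: "W s \<in> borel_measurable M" if "s \<in> {0..t}" for s
    using W that t by (auto simp: standard_brownian_motion_def)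
  obtain n c p where p': "\<forall>k. mono_on {..n k} (p k) \<and> 0 \<le> p k 0 \<and> p k (n k) \<le> t"
    and "(\<lambda>k. \<integral>\<^sup>+ x\<in>{0..t}. ennreal (((t - x) powr (H - 1 / 2) - step_fun (n k) (c k) (p k) x)\<^sup>2) \<partial>lborel) \<longlonglongrightarrow> 0"
    and AE: "AE \<omega> in M. (\<lambda>k. step_integral W (n k) (c k) (p k) \<omega>) \<longlonglongrightarrow> R t \<omega>"
    by (rule has_wiener_integral_AE[OF Wm I]) blast
  have p: "mono_on {..n k} (p k)" "0 \<le> p k 0" "p k (n k) \<le> t" for k
    using p' by auto
  have pk: "p k i \<in> {0..t}" if "i \<le> n k" for k i
    using mono_onD[OF p(1), of 0 k i] mono_onD[OF p(1), of i k "n k"] that p(2,3)[of k] by simp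
  show ?thesis
  proof (rule augmented_filtration_AE_eq)
    show "(\<lambda>\<omega>. lim (\<lambda>k. step_integral W (n k) (c k) (p k) \<omega>)) \<in> borel_measurable (augmented_filtration M W t)"
      by (intro borel_measurable_lim_metric measurable_step_integral pk)
    show "R t \<in> borel_measurable M" using I by (simp add: has_wiener_integral_def)
    show "AE \<omega> in M. lim (\<lambda>k. step_integral W (n k) (c k) (p k) \<omega>) = R t \<omega>"
      using AE by eventually_elim (rule limI)
  qed
qed

text \<open>Increments of \<open>R\<close> are not independent of the past, but the part of the
  Wiener integral for \<open>R t\<close> that runs over \<open>(s, t]\<close> is. Its variance is
  bounded below by the kernel energy there; the bound is proved for step integrals and survives the
  limit.\<close>

lemma (in prob_space) char_riemann_liouville_increment_le:
  assumes W: "standard_brownian_motion M T W" and R: "riemann_liouville_process M T W H R"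
    and H: "0 < H" "H < 1" and st: "0 \<le> s" "s < t" "t \<le> T"
  shows "norm (char (distr M borel (\<lambda>\<omega>. R t \<omega> - R s \<omega>)) u)
    \<le> exp (- (((t - s) powr H / 4)\<^sup>2 * u\<^sup>2) / 2)"
proof -
  have I: "has_wiener_integral M W (\<lambda>s. (t - s) powr (H - 1 / 2)) t (R t)"
    using R st by (simp add: riemann_liouville_process_def)
  have Wm: "W s \<in> borel_measurable M" if "s \<in> {0..t}" for s
    using W that st by (auto simp: standard_brownian_motion_def)
  obtain n c p where p': "\<forall>k. mono_on {..n k} (p k) \<and> 0 \<le> p k 0 \<and> p k (n k) \<le> t"
    and \<delta>: "(\<lambda>k. \<integral>\<^sup>+ x\<in>{0..t}. ennreal (((t - x) powr (H - 1 / 2) - step_fun (n k) (c k) (p k) x)\<^sup>2) \<partial>lborel) \<longlonglongrightarrow> 0"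
    and AE: "AE \<omega> in M. (\<lambda>k. step_integral W (n k) (c k) (p k) \<omega>) \<longlonglongrightarrow> R t \<omega>"
    by (rule has_wiener_integral_AE[OF Wm I]) blast
  have p: "mono_on {..n k} (p k)" "0 \<le> p k 0" "p k (n k) \<le> t" for k
    using p' by auto
  have pk: "p k i \<in> {0..t}" if "i \<le> n k" for k i
    using mono_onD[OF p(1), of 0 k i] mono_onD[OF p(1), of i k "n k"] that p(2,3)[of k] by simp
  let ?J = "\<lambda>k. step_integral W (n k) (c k) (p k)"
  let ?q = "\<lambda>k i. max s (p k i)"
  let ?S = "\<lambda>k. \<Sum>i<n k. (c k i)\<^sup>2 * (?q k (Suc i) - ?q k i)"
  \<comment> \<open>The lower bound for the kernel energy on \<open>{s..t}\<close>. If a step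
    function has squared error below \<open>v / 4\<close>, then
    \<open>v \<le> 2 * (v / 4) + 2 * ?S k\<close>, so its own energy after \<open>s\<close> is at
    least \<open>v / 4\<close>, the square of \<open>(t - s) powr H / 4\<close>.\<close>
  define v where "v = (t - s) powr (2 * H) / 4"
  have v: "0 < v" using st by (simp add: v_def)
  have [measurable]: "?J k \<in> borel_measurable M" for k
    using st by (intro augmented_filtration_measurable_imp[OF W, of t] measurable_step_integral pk) auto
  have [measurable]: "R s \<in> borel_measurable M" "R t \<in> borel_measurable M"
    using R st by (auto simp: riemann_liouville_process_def has_wiener_integral_def)
  have bound: "norm (char (distr M borel (\<lambda>\<omega>. ?J k \<omega> - R s \<omega>)) u) \<le> exp (- (?S k * u\<^sup>2) / 2)" for k
  proof -
    \<comment> \<open>Everything that is known at time \<open>s\<close>, including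
      \<open>R s\<close> itself.\<close>
    let ?Z = "\<lambda>\<omega>. step_integral W (n k) (c k) (\<lambda>i. min s (p k i)) \<omega> - R s \<omega>"
    have "norm (char (distr M borel (\<lambda>\<omega>. ?Z \<omega> + step_integral W (n k) (c k) (?q k) \<omega>)) u) \<le> exp (- (?S k * u\<^sup>2) / 2)"
    proof (rule char_add_step_integral_le[OF W])
      show "mono_on {..n k} (?q k)"
        using p(1)[of k] by (auto simp: mono_on_def max.coboundedI2)
      show "0 \<le> ?q k 0" "?q k (n k) \<le> T" using st p(2,3)[of k] by auto
      have "?Z \<in> borel_measurable (augmented_filtration M W s)"
        using st pk by (intro borel_measurable_diff measurable_step_integral riemann_liouville_adapted[OF W R]) auto
      then show "?Z \<in> borel_measurable (augmented_filtration M W (?q k 0))"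
        by (rule augmented_filtration_mono) simp
    qed
    moreover have "?Z \<omega> + step_integral W (n k) (c k) (?q k) \<omega> = ?J k \<omega> - R s \<omega>" for \<omega>
      using step_integral_split[of W "n k" "c k" "p k" \<omega> s] by simp
    ultimately show ?thesis by simp
  qed
  have "\<forall>\<^sub>F k in sequentially. (\<integral>\<^sup>+ x\<in>{0..t}. ennreal (((t - x) powr (H - 1 / 2) - step_fun (n k) (c k) (p k) x)\<^sup>2) \<partial>lborel) < ennreal (v / 4)"
    using order_tendstoD(2)[OF \<delta>, of "ennreal (v / 4)"] v by simp
  then have "\<forall>\<^sub>F k in sequentially. v / 4 \<le> ?S k"
  proof eventually_elim
    case (elim k)
    let ?f = "\<lambda>x. (t - x) powr (H - 1 / 2)" and ?g = "step_fun (n k) (c k) (p k)"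
    have gm[measurable]: "?g \<in> borel_measurable borel" unfolding step_fun_def by measurable
    have S: "0 \<le> ?S k"
      using mono_onD[OF p(1), of _ k "Suc _"] by (intro sum_nonneg mult_nonneg_nonneg) (auto simp: max.coboundedI2)
    have "ennreal v \<le> (\<integral>\<^sup>+x\<in>{s..t}. ennreal ((?f x)\<^sup>2) \<partial>lborel)"
      unfolding v_def using H st by (intro nn_integral_kernel_ge) auto
    also have "\<dots> \<le> (\<integral>\<^sup>+x. 2 * (ennreal ((?f x - ?g x)\<^sup>2) * indicator {0..t} x) + 2 * (ennreal ((?g x)\<^sup>2) * indicator {s..t} x) \<partial>lborel)"
    proof (rule nn_integral_mono)
      fix x
      have "0 \<le> (?f x - 2 * ?g x)\<^sup>2" by simp
      then have "(?f x)\<^sup>2 \<le> 2 * (?f x - ?g x)\<^sup>2 + 2 * (?g x)\<^sup>2"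
        by (simp add: power2_eq_square algebra_simps)
      then have "ennreal ((?f x)\<^sup>2) \<le> ennreal (2 * (?f x - ?g x)\<^sup>2 + 2 * (?g x)\<^sup>2)" by (rule ennreal_leI)
      also have "\<dots> = 2 * ennreal ((?f x - ?g x)\<^sup>2) + 2 * ennreal ((?g x)\<^sup>2)"
        by (simp add: ennreal_plus ennreal_mult)
      finally show "ennreal ((?f x)\<^sup>2) * indicator {s..t} x
        \<le> 2 * (ennreal ((?f x - ?g x)\<^sup>2) * indicator {0..t} x) + 2 * (ennreal ((?g x)\<^sup>2) * indicator {s..t} x)"
        using st by (auto simp: indicator_def)
    qed
    also have "\<dots> = 2 * (\<integral>\<^sup>+x\<in>{0..t}. ennreal ((?f x - ?g x)\<^sup>2) \<partial>lborel) + 2 * (\<integral>\<^sup>+x\<in>{s..t}. ennreal ((?g x)\<^sup>2) \<partial>lborel)"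
      by (subst nn_integral_add) (auto simp: nn_integral_cmult)
    also have "\<dots> \<le> 2 * ennreal (v / 4) + 2 * ennreal (?S k)"
      using elim by (intro add_mono mult_left_mono nn_integral_step_fun_power2_le p) auto
    also have "\<dots> = ennreal (v / 2 + 2 * ?S k)"
    proof -
      have "2 * ennreal a = ennreal (2 * a)" if "0 \<le> a" for a
        using that by (simp add: ennreal_mult)
      then show ?thesis using v S by simp
    qed
    finally have "v \<le> v / 2 + 2 * ?S k"
      using v S by (subst (asm) ennreal_le_iff) auto
    then show "v / 4 \<le> ?S k" by simp
  qed
  then have ev: "\<forall>\<^sub>F k in sequentially. norm (char (distr M borel (\<lambda>\<omega>. ?J k \<omega> - R s \<omega>)) u) \<le> exp (- (v / 4 * u\<^sup>2) / 2)"
  proof (rule eventually_mono)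
    fix k assume "v / 4 \<le> ?S k"
    then have "v / 4 * u\<^sup>2 \<le> ?S k * u\<^sup>2" by (rule mult_right_mono) simp
    then have "exp (- (?S k * u\<^sup>2) / 2) \<le> exp (- (v / 4 * u\<^sup>2) / 2)" by simp
    with bound show "norm (char (distr M borel (\<lambda>\<omega>. ?J k \<omega> - R s \<omega>)) u) \<le> exp (- (v / 4 * u\<^sup>2) / 2)"
      by (rule order_trans)
  qed
  have "(\<lambda>k. char (distr M borel (\<lambda>\<omega>. ?J k \<omega> - R s \<omega>)) u) \<longlonglongrightarrow> char (distr M borel (\<lambda>\<omega>. R t \<omega> - R s \<omega>)) u"
  proof -
    have "char (distr M borel Y) u = (CLINT \<omega>|M. iexp (u * Y \<omega>))" if "Y \<in> borel_measurable M" for Y :: "'a \<Rightarrow> real"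
      using that by (simp add: char_def integral_distr)
    moreover have "(\<lambda>k. CLINT \<omega>|M. iexp (u * (?J k \<omega> - R s \<omega>))) \<longlonglongrightarrow> (CLINT \<omega>|M. iexp (u * (R t \<omega> - R s \<omega>)))"
    proof (rule integral_dominated_convergence[where w = "\<lambda>_. 1"])
      show "AE \<omega> in M. (\<lambda>k. iexp (u * (?J k \<omega> - R s \<omega>))) \<longlonglongrightarrow> iexp (u * (R t \<omega> - R s \<omega>))"
        using AE by eventually_elim (intro tendsto_intros)
    qed auto
    ultimately show ?thesis by simp
  qed
  from tendsto_upperbound[OF tendsto_norm[OF this] ev]
  have "norm (char (distr M borel (\<lambda>\<omega>. R t \<omega> - R s \<omega>)) u) \<le> exp (- (v / 4 * u\<^sup>2) / 2)" by simp
  also have "v / 4 = ((t - s) powr H / 4)\<^sup>2"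
    by (simp add: v_def power_divide power2_eq_square flip: powr_add)
  finally show ?thesis .
qed

text \<open>The small ball inequality with radius \<open>K * \<bar>t - s\<bar>\<close> and deviation
  \<open>\<bar>t - s\<bar> powr H / 4\<close>, whence the 8.\<close>

lemma (in prob_space) riemann_liouville_increment_small_ball:
  assumes W: "standard_brownian_motion M T W" and R: "riemann_liouville_process M T W H R"
    and H: "0 < H" "H < 1" and st: "s \<in> {0..T}" "t \<in> {0..T}" "s \<noteq> t" and K: "0 < K"
  shows "prob {\<omega> \<in> space M. \<bar>R t \<omega> - R s \<omega>\<bar> \<le> K * \<bar>t - s\<bar>} \<le> 8 * K * \<bar>t - s\<bar> powr (1 - H)"
proof -
  have *: "prob {\<omega> \<in> space M. \<bar>R t \<omega> - R s \<omega>\<bar> \<le> K * \<bar>t - s\<bar>} \<le> 8 * K * \<bar>t - s\<bar> powr (1 - H)"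
    if st: "0 \<le> s" "s < t" "t \<le> T" for s t
  proof -
    have [measurable]: "R s \<in> borel_measurable M" "R t \<in> borel_measurable M"
      using R st by (auto simp: riemann_liouville_process_def has_wiener_integral_def)
    have "prob {\<omega> \<in> space M. \<bar>R t \<omega> - R s \<omega>\<bar> \<le> K * (t - s)} \<le> 2 * (K * (t - s)) / ((t - s) powr H / 4)"
      using st K by (intro prob_small_ball_le char_riemann_liouville_increment_le[OF W R H]) auto
    also have "\<dots> = 8 * K * (t - s) powr (1 - H)"
      using st by (simp add: powr_diff)
    finally show ?thesis using st by simp
  qed
  show ?thesis
  proof (cases "s < t")
    case True
    with * st show ?thesis by simp
  next
    case False
    with *[of t s] st show ?thesis by (simp add: abs_minus_commute)
  qed
qed

section \<open>Level sets\<close>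

text \<open>
  A set of positive measure contains, by the Cauchy--Schwarz inequality, at least order \<open>1 / n\<close>
  of the pairs of points that lie in a common interval of length \<open>T / n\<close>, whereas the small ball
  estimate makes the expected measure of such pairs with increment at most \<open>K * \<bar>t - s\<bar>\<close> of
  smaller order.
\<close>

lemma (in prob_space) AE_lipschitz_set_null:
  fixes Y :: "real \<Rightarrow> 'a \<Rightarrow> real"
  assumes Y[measurable]: "case_prod Y \<in> borel_measurable (borel \<Otimes>\<^sub>M M)"
    and small: "\<And>s t. s \<in> {0..T} \<Longrightarrow> t \<in> {0..T} \<Longrightarrow> s \<noteq> t \<Longrightarrow>
      prob {\<omega> \<in> space M. \<bar>Y t \<omega> - Y s \<omega>\<bar> \<le> K * \<bar>t - s\<bar>} \<le> C * \<bar>t - s\<bar> powr \<gamma>"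
    and T: "0 < T" and C: "0 \<le> C" and \<gamma>: "0 < \<gamma>"
  shows "AE \<omega> in M. \<forall>E\<in>sets borel. E \<subseteq> {0..T} \<longrightarrow>
    (\<forall>s\<in>E. \<forall>t\<in>E. \<bar>Y t \<omega> - Y s \<omega>\<bar> \<le> K * \<bar>t - s\<bar>) \<longrightarrow> emeasure lborel E = 0"
proof -
  \<comment> \<open>The index \<open>j = n\<close> is allowed because the floor of
    \<open>s * n / T\<close> is \<open>n\<close> at \<open>s = T\<close>; then \<open>I n n\<close>
    is just \<open>{T}\<close>. For \<open>n = 0\<close> the division gives 0, hence the
    restrictions to \<open>1 \<le> n\<close>.\<close>
  define I where "I = (\<lambda>n j. {real j * (T / real n)..real (Suc j) * (T / real n)} \<inter> {0..T})"
  define A :: "nat \<Rightarrow> nat \<Rightarrow> real \<Rightarrow> real \<Rightarrow> 'a \<Rightarrow> ennreal" where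
    "A = (\<lambda>n j s t \<omega>. indicator (I n j) s * indicator (I n j) t *
      (if \<bar>Y t \<omega> - Y s \<omega>\<bar> \<le> K * \<bar>t - s\<bar> then 1 else 0))"
  \<comment> \<open>The weight \<open>Suc n\<close> is the number of intervals, as Cauchy-Schwarz
    over them requires.\<close>
  define F where "F = (\<lambda>n \<omega>. of_nat (Suc n) * (\<Sum>j\<le>n. \<integral>\<^sup>+s. \<integral>\<^sup>+t. A n j s t \<omega> \<partial>lborel \<partial>lborel))"
  have [measurable]: "I n j \<in> sets borel" for n j unfolding I_def by measurable
  have Y'[measurable (raw)]: "(\<lambda>x. Y (f x) (g x)) \<in> borel_measurable N"
    if "f \<in> borel_measurable N" "g \<in> measurable N M" for f g and N :: "((real \<times> 'a) \<times> real) measure"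
    using measurable_compose[OF measurable_Pair[OF that] Y] by simp
  have [measurable]: "(\<lambda>x. Y (f x) (g x)) \<in> borel_measurable N"
    if "f \<in> borel_measurable N" "g \<in> measurable N M" for f g and N :: "(('a \<times> real) \<times> real) measure"
    using measurable_compose[OF measurable_Pair[OF that] Y] by simp
  have Am1: "(\<lambda>(s, \<omega>). \<integral>\<^sup>+t. A n j s t \<omega> \<partial>lborel) \<in> borel_measurable (lborel \<Otimes>\<^sub>M M)" for n j
    unfolding A_def by measurable
  have Am2: "(\<lambda>(t, \<omega>). A n j s t \<omega>) \<in> borel_measurable (lborel \<Otimes>\<^sub>M M)" for n j s
    unfolding A_def by measurable
  have Am3[measurable]: "(\<lambda>\<omega>. \<integral>\<^sup>+s. \<integral>\<^sup>+t. A n j s t \<omega> \<partial>lborel \<partial>lborel) \<in> borel_measurable M" for n j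
    unfolding A_def by measurable
  have Fm: "F n \<in> borel_measurable M" for n
    unfolding F_def by measurable
  have len: "\<bar>t - s\<bar> \<le> T / real n" if "s \<in> I n j" "t \<in> I n j" for s t n j
  proof -
    have "real (Suc j) * (T / real n) = real j * (T / real n) + T / real n"
      by (simp add: distrib_right add_divide_distrib)
    with that show ?thesis unfolding I_def Int_iff atLeastAtMost_iff by linarith
  qed
  have emI: "emeasure lborel (I n j) \<le> ennreal (T / real n)" for n j
  proof -
    have "emeasure lborel (I n j) \<le> emeasure lborel {real j * (T / real n)..real (Suc j) * (T / real n)}"
      unfolding I_def by (intro emeasure_mono) auto
    also have "\<dots> = ennreal (real (Suc j) * (T / real n) - real j * (T / real n))"
      using T by (intro emeasure_lborel_Icc mult_right_mono) auto
    also have "real (Suc j) * (T / real n) - real j * (T / real n) = T / real n"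
      by (simp add: algebra_simps add_divide_distrib)
    finally show ?thesis .
  qed
  interpret lM: pair_sigma_finite lborel M ..
  have EA: "(\<integral>\<^sup>+\<omega>. \<integral>\<^sup>+s. \<integral>\<^sup>+t. A n j s t \<omega> \<partial>lborel \<partial>lborel \<partial>M)
      \<le> ennreal (C * (T / real n) powr \<gamma>) * (ennreal (T / real n) * ennreal (T / real n))" for n j
  proof -
    let ?c = "ennreal (C * (T / real n) powr \<gamma>)"
    have "(\<integral>\<^sup>+\<omega>. \<integral>\<^sup>+s. \<integral>\<^sup>+t. A n j s t \<omega> \<partial>lborel \<partial>lborel \<partial>M)
      = (\<integral>\<^sup>+s. \<integral>\<^sup>+\<omega>. \<integral>\<^sup>+t. A n j s t \<omega> \<partial>lborel \<partial>M \<partial>lborel)"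
      by (rule lM.Fubini'[OF Am1])
    also have "\<dots> = (\<integral>\<^sup>+s. \<integral>\<^sup>+t. \<integral>\<^sup>+\<omega>. A n j s t \<omega> \<partial>M \<partial>lborel \<partial>lborel)"
      by (intro nn_integral_cong lM.Fubini' Am2)
    also have "\<dots> \<le> (\<integral>\<^sup>+s. \<integral>\<^sup>+t. ?c * (indicator (I n j) s * indicator (I n j) t) \<partial>lborel \<partial>lborel)"
    \<comment> \<open>On the diagonal \<open>t = s\<close> the event is the whole space, so the
      inner inequality is claimed only for almost every \<open>t\<close>.\<close>
    proof (rule nn_integral_mono, rule nn_integral_mono_AE)
      fix s :: real
      show "AE t in lborel. (\<integral>\<^sup>+\<omega>. A n j s t \<omega> \<partial>M) \<le> ?c * (indicator (I n j) s * indicator (I n j) t)"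
        using AE_lborel_singleton[of s]
      proof eventually_elim
        case (elim t)
        show ?case
        proof (cases "s \<in> I n j \<and> t \<in> I n j")
          case True
          then have st: "s \<in> {0..T}" "t \<in> {0..T}" by (auto simp: I_def)
          have "(\<integral>\<^sup>+\<omega>. A n j s t \<omega> \<partial>M) = (\<integral>\<^sup>+\<omega>. indicator {\<omega> \<in> space M. \<bar>Y t \<omega> - Y s \<omega>\<bar> \<le> K * \<bar>t - s\<bar>} \<omega> \<partial>M)"
            using True by (intro nn_integral_cong) (auto simp: A_def indicator_def)
          also have "\<dots> = emeasure M {\<omega> \<in> space M. \<bar>Y t \<omega> - Y s \<omega>\<bar> \<le> K * \<bar>t - s\<bar>}"
            by (intro nn_integral_indicator) measurable
          also have "\<dots> \<le> ennreal (C * \<bar>t - s\<bar> powr \<gamma>)"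
            using small[OF st] elim by (auto simp: emeasure_eq_measure intro: ennreal_leI)
          also have "\<dots> \<le> ?c"
            using True len[of s n j t] C \<gamma> by (intro ennreal_leI mult_left_mono powr_mono2) auto
          finally show ?thesis using True by simp
        qed (auto simp: A_def)
      qed
    qed
    also have "\<dots> = ?c * (emeasure lborel (I n j) * emeasure lborel (I n j))"
      by (simp add: nn_integral_cmult nn_integral_multc mult.assoc)
    also have "\<dots> \<le> ?c * (ennreal (T / real n) * ennreal (T / real n))"
      by (intro mult_left_mono mult_mono emI) auto
    finally show ?thesis .
  qed
  have EF: "(\<integral>\<^sup>+\<omega>. F n \<omega> \<partial>M) \<le> ennreal (4 * C * T\<^sup>2 * (T / real n) powr \<gamma>)" if n: "1 \<le> n" for n
  proof -
    let ?c = "C * (T / real n) powr \<gamma>"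
    have "(\<integral>\<^sup>+\<omega>. F n \<omega> \<partial>M) = of_nat (Suc n) * (\<Sum>j\<le>n. \<integral>\<^sup>+\<omega>. \<integral>\<^sup>+s. \<integral>\<^sup>+t. A n j s t \<omega> \<partial>lborel \<partial>lborel \<partial>M)"
      unfolding F_def by (subst nn_integral_cmult, measurable) (subst nn_integral_sum, auto)
    also have "\<dots> \<le> of_nat (Suc n) * (\<Sum>j\<le>n. ennreal ?c * (ennreal (T / real n) * ennreal (T / real n)))"
      by (intro mult_left_mono sum_mono EA) auto
    also have "\<dots> = ennreal (real (Suc n) * (real (Suc n) * (?c * (T / real n * (T / real n)))))"
    proof -
      have "of_nat (Suc n) * (\<Sum>j\<le>n. ennreal a * (ennreal d * ennreal d))
          = ennreal (real (Suc n) * (real (Suc n) * (a * (d * d))))" if "0 \<le> a" "0 \<le> d" for a d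
        using that by (simp add: ennreal_mult ennreal_of_nat_eq_real_of_nat del: of_nat_Suc)
      then show ?thesis using C T by simp
    qed
    also have "\<dots> \<le> ennreal (4 * C * T\<^sup>2 * (T / real n) powr \<gamma>)"
    proof (rule ennreal_leI)
      \<comment> \<open>One factor \<open>Suc n\<close> is the weight in \<open>F\<close>, the other
        counts the intervals; against \<open>(T / n)\<^sup>2\<close> they leave at most 4.\<close>
      have "real (Suc n) / real n \<le> 2" using n by (simp add: field_simps)
      then have "(real (Suc n) / real n) * (real (Suc n) / real n) \<le> 2 * 2" by (intro mult_mono) auto
      then have "(?c * T\<^sup>2) * ((real (Suc n) / real n) * (real (Suc n) / real n)) \<le> (?c * T\<^sup>2) * 4"
        using C by (intro mult_left_mono) auto
      then show "real (Suc n) * (real (Suc n) * (?c * (T / real n * (T / real n)))) \<le> 4 * C * T\<^sup>2 * (T / real n) powr \<gamma>"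
        by (simp add: power2_eq_square mult_ac del: of_nat_Suc)
    qed
    finally show ?thesis .
  qed
  have "(\<integral>\<^sup>+\<omega>. liminf (\<lambda>n. F n \<omega>) \<partial>M) \<le> liminf (\<lambda>n. \<integral>\<^sup>+\<omega>. F n \<omega> \<partial>M)"
    by (rule nn_integral_liminf) (rule Fm)
  also have "\<dots> \<le> liminf (\<lambda>n. ennreal (4 * C * T\<^sup>2 * (T / real n) powr \<gamma>))"
    by (rule Liminf_mono) (use EF in \<open>auto simp: eventually_sequentially intro!: exI[of _ 1]\<close>)
  also have "\<dots> = 0"
  proof (rule lim_imp_Liminf)
    have "(\<lambda>n. 4 * C * T\<^sup>2 * (T / real n) powr \<gamma>) \<longlonglongrightarrow> 4 * C * T\<^sup>2 * 0"
    proof (intro tendsto_mult tendsto_const)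
      have "(\<lambda>n. T / real n) \<longlonglongrightarrow> 0"
        by (intro tendsto_divide_0[OF tendsto_const] filterlim_real_sequentially filterlim_at_top_imp_at_infinity)
      from tendsto_powr'[OF this tendsto_const[of \<gamma>]] \<gamma> T
      show "(\<lambda>n. (T / real n) powr \<gamma>) \<longlonglongrightarrow> 0" by simp
    qed
    then show "(\<lambda>n. ennreal (4 * C * T\<^sup>2 * (T / real n) powr \<gamma>)) \<longlonglongrightarrow> 0"
      by (auto dest: tendsto_ennrealI)
  qed simp
  \<comment> \<open>By Fatou, convergence of the means to 0 is enough; no summability and no choice
    of a subsequence.\<close>
  finally have "AE \<omega> in M. liminf (\<lambda>n. F n \<omega>) = 0"
    using Fm by (subst nn_integral_0_iff_AE[symmetric]) auto
  then show ?thesis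
  proof eventually_elim
    case (elim \<omega>)
    show ?case
    proof (intro ballI impI)
      fix E assume E[measurable]: "E \<in> sets borel" and ET: "E \<subseteq> {0..T}"
        and lip: "\<forall>s\<in>E. \<forall>t\<in>E. \<bar>Y t \<omega> - Y s \<omega>\<bar> \<le> K * \<bar>t - s\<bar>"
      have fin: "emeasure lborel (E \<inter> J) < \<infinity>" for J
      proof -
        have "emeasure lborel (E \<inter> J) \<le> emeasure lborel {0..T}"
          using ET by (intro emeasure_mono) auto
        also have "\<dots> < \<infinity>" using T by simp
        finally show ?thesis .
      qed
      \<comment> \<open>The right-hand side does not involve \<open>E\<close>, so one null set of
        \<open>\<omega>\<close> serves all sets \<open>E\<close> at once.\<close>
      have "(emeasure lborel E)\<^sup>2 \<le> F n \<omega>" if n: "1 \<le> n" for n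
      proof -
        let ?m = "\<lambda>j. measure lborel (E \<inter> I n j)"
        have em: "emeasure lborel (E \<inter> I n j) = ennreal (?m j)" for j
          using fin[of "I n j"] by (simp add: emeasure_eq_ennreal_measure)
        have "E \<subseteq> (\<Union>j\<in>{..n}. E \<inter> I n j)"
        proof
          fix s assume s: "s \<in> E"
          with ET have sT: "0 \<le> s" "s \<le> T" by auto
          define j where "j = nat \<lfloor>s * real n / T\<rfloor>"
          have "s * real n / T \<le> real n" using sT T n by (simp add: field_simps)
          then have "\<lfloor>s * real n / T\<rfloor> \<le> int n" by (simp add: floor_le_iff)
          then have "j \<le> n" by (simp add: j_def)
          have 0: "0 \<le> s * real n / T" using sT T by simp
          then have "real j \<le> s * real n / T" "s * real n / T \<le> real (Suc j)"
            unfolding j_def by linarith+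
          then have "s \<in> I n j" using sT T n by (simp add: I_def field_simps)
          then show "s \<in> (\<Union>j\<in>{..n}. E \<inter> I n j)" using s \<open>j \<le> n\<close> by blast
        qed
        then have "emeasure lborel E \<le> emeasure lborel (\<Union>j\<in>{..n}. E \<inter> I n j)"
          by (rule emeasure_mono) measurable
        also have "\<dots> \<le> (\<Sum>j\<le>n. emeasure lborel (E \<inter> I n j))"
          by (rule emeasure_subadditive_finite) auto
        also have "\<dots> = ennreal (\<Sum>j\<le>n. ?m j)" by (simp add: em)
        finally have "(emeasure lborel E)\<^sup>2 \<le> (ennreal (\<Sum>j\<le>n. ?m j))\<^sup>2"
          by (intro power_mono) auto
        also have "\<dots> = ennreal ((\<Sum>j\<le>n. ?m j)\<^sup>2)"
          by (intro ennreal_power sum_nonneg) auto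
        also have "\<dots> \<le> ennreal (real (Suc n) * (\<Sum>j\<le>n. (?m j)\<^sup>2))"
          using sum_squared_le_sum_of_squares[of ?m "{..n}"]
          by (intro ennreal_leI) (simp add: mult.commute)
        also have "\<dots> = of_nat (Suc n) * (\<Sum>j\<le>n. (emeasure lborel (E \<inter> I n j))\<^sup>2)"
          by (simp add: em ennreal_power ennreal_mult sum_nonneg ennreal_of_nat_eq_real_of_nat del: of_nat_Suc)
        also have "\<dots> \<le> F n \<omega>"
          unfolding F_def
        proof (intro mult_left_mono sum_mono)
          fix j
          have "(emeasure lborel (E \<inter> I n j))\<^sup>2
            = (\<integral>\<^sup>+s. \<integral>\<^sup>+t. indicator (E \<inter> I n j) s * indicator (E \<inter> I n j) t \<partial>lborel \<partial>lborel)"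
            by (simp add: nn_integral_cmult nn_integral_multc power2_eq_square)
          also have "\<dots> \<le> (\<integral>\<^sup>+s. \<integral>\<^sup>+t. A n j s t \<omega> \<partial>lborel \<partial>lborel)"
            using lip by (intro nn_integral_mono) (auto simp: A_def indicator_def)
          finally show "(emeasure lborel (E \<inter> I n j))\<^sup>2 \<le> (\<integral>\<^sup>+s. \<integral>\<^sup>+t. A n j s t \<omega> \<partial>lborel \<partial>lborel)" .
        qed auto
        finally show ?thesis .
      qed
      then have "(emeasure lborel E)\<^sup>2 \<le> liminf (\<lambda>n. F n \<omega>)"
        by (intro Liminf_bounded) (auto simp: eventually_sequentially intro!: exI[of _ 1])
      with elim show "emeasure lborel E = 0" by simp
    qed
  qed
qed

section \<open>Measurability and adaptedness\<close>

text \<open>Time is rounded down to multiples of \<open>1 / Suc n\<close>; the rounded process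
  involves countably many random variables and converges by path continuity.\<close>

lemma borel_measurable_continuous_process:
  fixes X :: "real \<Rightarrow> 'a \<Rightarrow> real"
  assumes [measurable]: "\<And>s. X s \<in> borel_measurable N"
    and cont: "\<And>\<omega>. \<omega> \<in> space N \<Longrightarrow> continuous_on UNIV (\<lambda>s. X s \<omega>)"
  shows "case_prod X \<in> borel_measurable (borel \<Otimes>\<^sub>M N)"
proof (rule borel_measurable_LIMSEQ_real)
  let ?f = "\<lambda>n s. real_of_int \<lfloor>real (Suc n) * s\<rfloor> / real (Suc n)"
  show "(\<lambda>p. X (?f n (fst p)) (snd p)) \<in> borel_measurable (borel \<Otimes>\<^sub>M N)" for n
    by (rule measurable_compose_countable[where g = "\<lambda>p. \<lfloor>real (Suc n) * fst p\<rfloor>"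
          and f = "\<lambda>i p. X (real_of_int i / real (Suc n)) (snd p)"]) measurable
  fix p :: "real \<times> 'a" assume "p \<in> space (borel \<Otimes>\<^sub>M N)"
  then have \<omega>: "snd p \<in> space N" by (auto simp: space_pair_measure)
  have "(\<lambda>n. ?f n (fst p)) \<longlonglongrightarrow> fst p"
  proof (rule LIM_zero_cancel, rule Lim_null_comparison)
    have "\<bar>?f n s - s\<bar> \<le> 1 / real (Suc n)" for n s
    proof -
      have "?f n s - s = (real_of_int \<lfloor>real (Suc n) * s\<rfloor> - real (Suc n) * s) / real (Suc n)"
        by (simp add: diff_divide_distrib del: of_nat_Suc)
      moreover have "\<bar>real_of_int \<lfloor>real (Suc n) * s\<rfloor> - real (Suc n) * s\<bar> \<le> 1" by linarith
      ultimately show ?thesis by (simp add: abs_divide divide_right_mono del: of_nat_Suc)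
    qed
    then show "\<forall>\<^sub>F n in sequentially. norm (?f n (fst p) - fst p) \<le> 1 / real (Suc n)"
      by (intro always_eventually) simp
    show "(\<lambda>n. 1 / real (Suc n)) \<longlonglongrightarrow> 0"
      using LIMSEQ_inverse_real_of_nat by (simp add: inverse_eq_divide)
  qed
  then show "(\<lambda>n. X (?f n (fst p)) (snd p)) \<longlonglongrightarrow> case_prod X p"
    using cont[OF \<omega>] by (auto simp: split_beta' continuous_on_eq_continuous_at intro: isCont_tendsto_compose)
qed


text \<open>Clamping time to \<open>{0..t}\<close> gives a process continuous on the whole line and
  measurable for the single sigma-algebra \<open>N\<close>. With \<open>N\<close> the filtration at
  time \<open>t\<close> this is progressive measurability.\<close>

lemma borel_measurable_path_integral:
  fixes X :: "real \<Rightarrow> 'a \<Rightarrow> real" and g :: "real \<Rightarrow> real \<Rightarrow> real"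
  assumes g[measurable]: "case_prod g \<in> borel_measurable (borel \<Otimes>\<^sub>M borel)" and t: "0 \<le> t"
    and X: "\<And>s. s \<in> {0..t} \<Longrightarrow> X s \<in> borel_measurable N"
    and cont: "\<And>\<omega>. \<omega> \<in> space N \<Longrightarrow> continuous_on {0..t} (\<lambda>s. X s \<omega>)"
  shows "(\<lambda>\<omega>. LINT s:{0..t}|lborel. g s (X s \<omega>)) \<in> borel_measurable N"
proof -
  define Z where "Z = (\<lambda>s. X (max 0 (min t s)))"
  have Z: "case_prod Z \<in> borel_measurable (borel \<Otimes>\<^sub>M N)"
  proof (rule borel_measurable_continuous_process)
    show "Z s \<in> borel_measurable N" for s
      unfolding Z_def using t by (intro X) auto
    show "continuous_on UNIV (\<lambda>s. Z s \<omega>)" if "\<omega> \<in> space N" for \<omega>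
      unfolding Z_def
      by (rule continuous_on_compose2[OF cont[OF that]]) (use t in \<open>auto intro!: continuous_intros\<close>)
  qed
  have [measurable]: "(\<lambda>p. Z (snd p) (fst p)) \<in> borel_measurable (N \<Otimes>\<^sub>M borel)"
    using measurable_compose[OF measurable_Pair[OF measurable_snd measurable_fst] Z] by simp
  have "(\<lambda>\<omega>. \<integral>s. indicator {0..t} s *\<^sub>R g s (Z s \<omega>) \<partial>lborel) \<in> borel_measurable N"
    by (intro lborel.borel_measurable_lebesgue_integral) (simp add: split_beta')
  also have "(\<lambda>\<omega>. \<integral>s. indicator {0..t} s *\<^sub>R g s (Z s \<omega>) \<partial>lborel)
      = (\<lambda>\<omega>. LINT s:{0..t}|lborel. g s (X s \<omega>))"
    unfolding set_lebesgue_integral_def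
    by (intro ext Bochner_Integration.integral_cong) (auto simp: Z_def indicator_def max_def min_def)
  finally show ?thesis .
qed

lemma picard_adapted:
  assumes g: "case_prod g \<in> borel_measurable (borel \<Otimes>\<^sub>M borel)"
    and growth: "\<And>s x. \<bar>g s x\<bar> \<le> C * (1 + \<bar>x\<bar>)"
    and r: "\<And>t. t \<in> {0..T} \<Longrightarrow> (\<lambda>\<omega>. r \<omega> t) \<in> borel_measurable (augmented_filtration M W t)"
    and cont: "\<And>\<omega>. \<omega> \<in> space M \<Longrightarrow> continuous_on {0..T} (r \<omega>)"
    and t: "t \<in> {0..T}"
  shows "(\<lambda>\<omega>. picard g (r \<omega>) k t) \<in> borel_measurable (augmented_filtration M W t)"
  using t
proof (induction k arbitrary: t)
  case 0
  then show ?case by (simp add: r)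
next
  case (Suc k)
  have "(\<lambda>\<omega>. LINT s:{0..t}|lborel. g s (picard g (r \<omega>) k s)) \<in> borel_measurable (augmented_filtration M W t)"
  proof (rule borel_measurable_path_integral[OF g])
    show "(\<lambda>\<omega>. picard g (r \<omega>) k s) \<in> borel_measurable (augmented_filtration M W t)" if "s \<in> {0..t}" for s
      using that Suc.prems by (intro augmented_filtration_mono[OF Suc.IH]) auto
    show "continuous_on {0..t} (\<lambda>s. picard g (r \<omega>) k s)"
      if "\<omega> \<in> space (augmented_filtration M W t)" for \<omega>
      using that Suc.prems
      by (intro continuous_on_subset[OF continuous_on_picard[OF g growth cont]]) auto
  qed (use Suc.prems in auto)
  then show ?case using r[OF Suc.prems] by simp
qed

text \<open>A \<open>lim\<close> of a \<open>lim\<close> of adapted iterates; convergence plays no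
  part in the measurability.\<close>

lemma maximal_solution_adapted:
  assumes b: "case_prod b \<in> borel_measurable (borel \<Otimes>\<^sub>M borel)"
    and growth: "\<And>s x. \<bar>b s x\<bar> \<le> C * (1 + \<bar>x\<bar>)"
    and r: "\<And>t. t \<in> {0..T} \<Longrightarrow> (\<lambda>\<omega>. r \<omega> t) \<in> borel_measurable (augmented_filtration M W t)"
    and cont: "\<And>\<omega>. \<omega> \<in> space M \<Longrightarrow> continuous_on {0..T} (r \<omega>)"
    and t: "t \<in> {0..T}"
  shows "(\<lambda>\<omega>. maximal_solution b C (r \<omega>) t) \<in> borel_measurable (augmented_filtration M W t)"
proof -
  have n: "C \<le> real (nat \<lceil>C\<rceil> + n)" for n by linarith
  show ?thesis
    unfolding maximal_solution_def picard_limit_def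
    by (intro borel_measurable_lim_metric
      picard_adapted[OF borel_measurable_sup_conv[OF growth b n] sup_conv_abs_le[OF growth n] r cont t])
qed

section \<open>Continuity points and measurability of the drift\<close>

lemma piecewise_uniformly_continuous_isCont:
  assumes g: "piecewise_uniformly_continuous m a g" and x: "x \<notin> a ` {1..m}"
  shows "isCont g x"
proof -
  note g = g[unfolded piecewise_uniformly_continuous_def]
  have *: "isCont g x" if "open A" "x \<in> A" "uniformly_continuous_on A g" for A
    using uniformly_continuous_imp_continuous[OF that(3)] that by (simp add: continuous_on_eq_continuous_at)
  have ne: "x \<noteq> a i" if "i \<in> {1..m}" for i using x that by auto
  consider "x < a 1" | "a m < x" | "a 1 < x" "x < a m"
    using ne[of 1] ne[of m] g by force
  then show ?thesis
  proof cases
    case 1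
    then show ?thesis using g by (intro *[of "{..<a 1}"]) auto
  next
    case 2
    then show ?thesis using g by (intro *[of "{a m<..}"]) auto
  next
    case 3
    define J where "J = {j \<in> {1..m}. a j < x}"
    have "finite J" "J \<noteq> {}" using 3 g by (auto simp: J_def)
    define i where "i = Max J"
    have iJ: "i \<in> J" unfolding i_def by (rule Max_in) fact+
    then have i: "1 \<le> i" "i \<le> m" "a i < x" by (auto simp: J_def)
    have "i \<noteq> m" using i(3) 3 by auto
    then have im: "i < m" using i by simp
    have "Suc i \<notin> J" using Max_ge[OF \<open>finite J\<close>, of "Suc i"] by (auto simp: i_def)
    then have "x < a (Suc i)" using im ne[of "Suc i"] by (auto simp: J_def)
    then show ?thesis using g i im by (intro *[of "{a i<..<a (Suc i)}"]) auto
  qed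
qed

text \<open>The pathwise results ask for drifts on the whole plane; the value 0 outside
  \<open>{0..T}\<close> respects any linear growth bound.\<close>

lemma drift_measurable_extend:
  assumes "drift_measurable T b"
  shows "case_prod (\<lambda>t x. if t \<in> {0..T} then b t x else 0) \<in> borel_measurable (borel \<Otimes>\<^sub>M borel)"
proof -
  have "{0..T} \<times> UNIV \<in> sets (borel :: (real \<times> real) measure)"
    by (simp flip: borel_prod)
  then have "(\<lambda>p. indicator ({0..T} \<times> UNIV) p *\<^sub>R (case p of (t, x) \<Rightarrow> b t x)) \<in> borel_measurable (borel :: (real \<times> real) measure)"
    using assms unfolding drift_measurable_def by (subst (asm) borel_measurable_restrict_space_iff) auto
  also have "(\<lambda>p. indicator ({0..T} \<times> UNIV) p *\<^sub>R (case p of (t, x) \<Rightarrow> b t x))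
      = case_prod (\<lambda>t x. if t \<in> {0..T} then b t x else 0)"
    by (auto simp: indicator_def)
  finally show ?thesis by (simp add: borel_prod)
qed

lemma drift_path_measurable:
  assumes b: "drift_measurable T b" and X: "continuous_on {0..T} X" and t: "t \<in> {0..T}"
  shows "set_borel_measurable lborel {0..t} (\<lambda>s. b s (X s))"
proof -
  have "continuous_on {0..t} X" using t by (intro continuous_on_subset[OF X]) auto
  from set_borel_measurable_path[OF drift_measurable_extend[OF b] this]
  show ?thesis
    unfolding set_borel_measurable_def
    by (rule measurable_cong[THEN iffD1, rotated]) (use t in \<open>auto simp: indicator_def\<close>)
qed

section \<open>Strong solutions\<close>

locale riemann_liouville_sde = prob_space M for M :: "'a measure" +
  fixes T H x0 :: real and W R :: "real \<Rightarrow> 'a \<Rightarrow> real"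
  assumes T_pos: "0 < T"
    and brownian: "standard_brownian_motion M T W"
    and H_pos: "0 < H" and H_less_1: "H < 1"
    and riemann_liouville: "riemann_liouville_process M T W H R"
begin

lemma T_mem: "T \<in> {0..T}" using T_pos by simp

text \<open>Joint measurability and the Picard scheme need continuity of every path, while
  \<open>R\<close> has it almost surely. Setting \<open>R\<close> to 0 on a null set keeps it
  adapted because the filtration is augmented.\<close>

lemma continuous_version:
  obtains V where "\<And>t. t \<in> {0..T} \<Longrightarrow> V t \<in> borel_measurable (augmented_filtration M W t)"
    and "\<And>\<omega>. continuous_on {0..T} (\<lambda>t. V t \<omega>)"
    and "AE \<omega> in M. \<forall>t\<in>{0..T}. V t \<omega> = R t \<omega>"
proof -
  have "AE \<omega> in M. continuous_on {0..T} (\<lambda>t. R t \<omega>)"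
    using riemann_liouville by (simp add: riemann_liouville_process_def)
  then obtain N where N: "N \<in> null_sets M" "{\<omega> \<in> space M. \<not> continuous_on {0..T} (\<lambda>t. R t \<omega>)} \<subseteq> N"
    by (auto elim!: AE_E simp: null_sets_def)
  define V where "V = (\<lambda>t \<omega>. if \<omega> \<in> space M - N then R t \<omega> else 0)"
  show ?thesis
  proof (rule that[of V])
    have ae: "AE \<omega> in M. \<omega> \<in> space M - N"
      using AE_not_in[OF N(1)] AE_space by eventually_elim simp
    show "V t \<in> borel_measurable (augmented_filtration M W t)" if t: "t \<in> {0..T}" for t
    proof (rule augmented_filtration_AE_eq)
      show Rt: "R t \<in> borel_measurable (augmented_filtration M W t)"
        by (rule riemann_liouville_adapted[OF brownian riemann_liouville t])
      have [measurable]: "R t \<in> borel_measurable M" "N \<in> sets M"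
        using augmented_filtration_measurable_imp[OF brownian _ Rt] t N(1) by auto
      show "V t \<in> borel_measurable M" unfolding V_def by measurable
      show "AE \<omega> in M. R t \<omega> = V t \<omega>" using ae by eventually_elim (simp add: V_def)
    qed
    show "continuous_on {0..T} (\<lambda>t. V t \<omega>)" for \<omega>
      using N(2) by (cases "\<omega> \<in> space M - N") (auto simp: V_def)
    show "AE \<omega> in M. \<forall>t\<in>{0..T}. V t \<omega> = R t \<omega>" using ae by eventually_elim (simp add: V_def)
  qed
qed

text \<open>
  The exceptional set does not depend on the Lipschitz perturbation \<open>\<lambda>t. X t - R t \<omega>\<close>, which may
  hence be random and need not be adapted.
\<close>

lemma AE_level_sets_null:
  "AE \<omega> in M. \<forall>X K c. K-lipschitz_on {0..T} (\<lambda>t. X t - R t \<omega>) \<longrightarrow>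
     (AE s in lborel. s \<in> {0..T} \<longrightarrow> X s \<noteq> c)"
proof -
  obtain V where V: "\<And>t. t \<in> {0..T} \<Longrightarrow> V t \<in> borel_measurable (augmented_filtration M W t)"
    and cont: "\<And>\<omega>. continuous_on {0..T} (\<lambda>t. V t \<omega>)"
    and VR: "AE \<omega> in M. \<forall>t\<in>{0..T}. V t \<omega> = R t \<omega>"
    using continuous_version by blast
  define Y where "Y = (\<lambda>s. V (max 0 (min T s)))"
  have Vm: "V t \<in> borel_measurable M" if "t \<in> {0..T}" for t
    using augmented_filtration_measurable_imp[OF brownian _ V[OF that]] that by simp
  have Ym: "case_prod Y \<in> borel_measurable (borel \<Otimes>\<^sub>M M)"
  proof (rule borel_measurable_continuous_process)
    show "Y s \<in> borel_measurable M" for s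
      unfolding Y_def using T_pos by (intro Vm) auto
    show "continuous_on UNIV (\<lambda>s. Y s \<omega>)" for \<omega>
      unfolding Y_def by (rule continuous_on_compose2[OF cont]) (use T_pos in \<open>auto intro!: continuous_intros\<close>)
  qed
  have YV: "Y t = V t" if "t \<in> {0..T}" for t
  proof -
    have "max 0 (min T t) = t" using that by auto
    then show ?thesis by (simp add: Y_def)
  qed
  \<comment> \<open>Integer Lipschitz constants suffice, so only countably many null sets are
    united. \<open>Suc k\<close> keeps the constant positive, as the small ball estimate
    demands.\<close>
  have "AE \<omega> in M. \<forall>E\<in>sets borel. E \<subseteq> {0..T} \<longrightarrow>
    (\<forall>s\<in>E. \<forall>t\<in>E. \<bar>Y t \<omega> - Y s \<omega>\<bar> \<le> real (Suc k) * \<bar>t - s\<bar>) \<longrightarrow> emeasure lborel E = 0" for k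
  proof (rule AE_lipschitz_set_null[OF Ym _ T_pos])
    fix s t assume st: "s \<in> {0..T}" "t \<in> {0..T}" "s \<noteq> t"
    have [measurable]: "R t \<in> borel_measurable M" "R s \<in> borel_measurable M"
      using riemann_liouville st by (auto simp: riemann_liouville_process_def has_wiener_integral_def)
    have [measurable]: "V t \<in> borel_measurable M" "V s \<in> borel_measurable M" using Vm st by auto
    have "prob {\<omega> \<in> space M. \<bar>Y t \<omega> - Y s \<omega>\<bar> \<le> real (Suc k) * \<bar>t - s\<bar>}
      = prob {\<omega> \<in> space M. \<bar>R t \<omega> - R s \<omega>\<bar> \<le> real (Suc k) * \<bar>t - s\<bar>}"
      using VR st by (intro measure_eq_AE) (auto simp: YV elim!: eventually_mono)
    also have "\<dots> \<le> 8 * real (Suc k) * \<bar>t - s\<bar> powr (1 - H)"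
      using st by (intro riemann_liouville_increment_small_ball[OF brownian riemann_liouville H_pos H_less_1]) auto
    finally show "prob {\<omega> \<in> space M. \<bar>Y t \<omega> - Y s \<omega>\<bar> \<le> real (Suc k) * \<bar>t - s\<bar>}
      \<le> 8 * real (Suc k) * \<bar>t - s\<bar> powr (1 - H)" .
  qed (use H_less_1 in auto)
  then have "AE \<omega> in M. \<forall>k. \<forall>E\<in>sets borel. E \<subseteq> {0..T} \<longrightarrow>
    (\<forall>s\<in>E. \<forall>t\<in>E. \<bar>Y t \<omega> - Y s \<omega>\<bar> \<le> real (Suc k) * \<bar>t - s\<bar>) \<longrightarrow> emeasure lborel E = 0"
    by (simp add: AE_all_countable)
  with VR show ?thesis
  proof eventually_elim
    case (elim \<omega>)
    show ?case
    proof (intro allI impI)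
      fix X K c assume lip: "K-lipschitz_on {0..T} (\<lambda>t. X t - R t \<omega>)"
      obtain k :: nat where k: "K \<le> real k" using real_arch_simple by blast
      have "continuous_on {0..T} (\<lambda>t. (X t - R t \<omega>) + V t \<omega>)"
        by (intro continuous_on_add lipschitz_on_continuous_on[OF lip] cont)
      then have contX: "continuous_on {0..T} X"
        by (rule continuous_on_eq) (use elim in auto)
      define E where "E = {s \<in> {0..T}. X s = c}"
      have "closed E" unfolding E_def
        by (rule continuous_closed_preimage_constant[OF contX]) simp
      moreover have "\<bar>Y t \<omega> - Y s \<omega>\<bar> \<le> real (Suc k) * \<bar>t - s\<bar>" if "s \<in> E" "t \<in> E" for s t
      proof -
        \<comment> \<open>Since \<open>X s\<close> and \<open>X t\<close> both equal
          \<open>c\<close>, this is the increment of \<open>R\<close> up to sign.\<close>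
        have "\<bar>(X t - R t \<omega>) - (X s - R s \<omega>)\<bar> \<le> K * \<bar>t - s\<bar>"
          using lipschitz_onD[OF lip, of t s] that by (simp add: E_def dist_real_def)
        also have "\<dots> \<le> real (Suc k) * \<bar>t - s\<bar>"
          using k by (intro mult_right_mono) auto
        finally show ?thesis using that elim(1) by (simp add: E_def YV abs_minus_commute)
      qed
      moreover have "E \<subseteq> {0..T}" by (auto simp: E_def)
      ultimately have "emeasure lborel E = 0"
        using elim(2) borel_closed by blast
      then have "E \<in> null_sets lborel" using \<open>closed E\<close> by (simp add: null_sets_def)
      from AE_not_in[OF this] show "AE s in lborel. s \<in> {0..T} \<longrightarrow> X s \<noteq> c"
        by eventually_elim (simp add: E_def)
    qed
  qed
qed

text \<open>The null set of \<open>\<omega>\<close> is already common to all levels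
  \<open>c\<close>; countability of \<open>S\<close> is used for the null sets of times
  \<open>s\<close>.\<close>

lemma AE_avoids_countable:
  assumes "countable S"
  shows "AE \<omega> in M. \<forall>X K. K-lipschitz_on {0..T} (\<lambda>t. X t - R t \<omega>) \<longrightarrow>
     (AE s in lborel. s \<in> {0..T} \<longrightarrow> X s \<notin> S)"
  using AE_level_sets_null
proof eventually_elim
  case (elim \<omega>)
  show ?case
  proof (intro allI impI)
    fix X K assume "K-lipschitz_on {0..T} (\<lambda>t. X t - R t \<omega>)"
    with elim have "AE s in lborel. s \<in> {0..T} \<longrightarrow> X s \<noteq> c" for c by blast
    then have "AE s in lborel. \<forall>c\<in>S. s \<in> {0..T} \<longrightarrow> X s \<noteq> c"
      by (subst AE_ball_countable[OF assms]) blast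
    then show "AE s in lborel. s \<in> {0..T} \<longrightarrow> X s \<notin> S"
      by eventually_elim auto
  qed
qed

lemma AE_continuous: "AE \<omega> in M. continuous_on {0..T} (\<lambda>t. R t \<omega>)"
  using riemann_liouville by (simp add: riemann_liouville_process_def)

lemma bounded_drift_lipschitz:
  assumes X: "strong_solution M T W R x0 b X"
    and K: "\<forall>t\<in>{0..T}. \<forall>x. \<bar>b t x\<bar> \<le> K"
  shows "AE \<omega> in M. K-lipschitz_on {0..T} (\<lambda>t. X t \<omega> - R t \<omega>)"
proof -
  have "AE \<omega> in M. \<forall>t\<in>{0..T}. set_integrable lborel {0..t} (\<lambda>s. b s (X s \<omega>)) \<and>
        X t \<omega> = x0 + (LINT s:{0..t}|lborel. b s (X s \<omega>)) + R t \<omega>"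
    using X by (simp add: strong_solution_def)
  then show ?thesis
  proof eventually_elim
    case (elim \<omega>)
    have K0: "0 \<le> K" using K T_mem abs_ge_zero[of "b T 0"] by (meson order_trans)
    have *: "\<bar>(X t \<omega> - R t \<omega>) - (X s \<omega> - R s \<omega>)\<bar> \<le> K * (t - s)" if st: "0 \<le> s" "s \<le> t" "t \<le> T" for s t
    proof -
      have "(X t \<omega> - R t \<omega>) - (X s \<omega> - R s \<omega>) = (LINT u:{s<..t}|lborel. b u (X u \<omega>))"
        using elim st set_integral_split[of 0 t "\<lambda>u. b u (X u \<omega>)" s] by auto
      moreover have "\<bar>LINT u:{s<..t}|lborel. b u (X u \<omega>)\<bar> \<le> (LINT u:{s<..t}|lborel. K)"
      proof (rule abs_set_integral_le)
        show "set_integrable lborel {s<..t} (\<lambda>u. b u (X u \<omega>))"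
          by (rule set_integrable_subset[of _ "{0..t}"]) (use st elim in auto)
        show "set_integrable lborel {s<..t} (\<lambda>u. K)"
          by (rule set_integrable_subset[of _ "{s..t}"]) (auto intro: borel_integrable_atLeastAtMost')
      qed (use st K in auto)
      moreover have "(LINT u:{s<..t}|lborel. K) = K * (t - s)"
        using st by (simp add: set_lebesgue_integral_def)
      ultimately show ?thesis by simp
    qed
    show ?case
    proof (rule lipschitz_onI[OF _ K0])
      fix t s assume "t \<in> {0..T}" "s \<in> {0..T}"
      then show "dist (X t \<omega> - R t \<omega>) (X s \<omega> - R s \<omega>) \<le> K * dist t s"
        using *[of s t] *[of t s] unfolding dist_real_def by (cases "s \<le> t") auto
    qed
  qed
qed

text \<open>Along the path the two drifts differ only on a null set of times. The Lipschitz property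
  is asked of the given solution, so the new drift \<open>b'\<close> may be unbounded, as in the
  existence part of (ii).\<close>

lemma strong_solution_change_drift:
  assumes X: "strong_solution M T W R x0 b X"
    and lip: "AE \<omega> in M. \<exists>K. K-lipschitz_on {0..T} (\<lambda>t. X t \<omega> - R t \<omega>)"
    and b: "drift_measurable T b" and b': "drift_measurable T b'"
    and S: "countable S" and eq: "\<And>t x. t \<in> {0..T} \<Longrightarrow> x \<notin> S \<Longrightarrow> b t x = b' t x"
  shows "strong_solution M T W R x0 b' X"
  unfolding strong_solution_def
proof
  show "\<forall>t\<in>{0..T}. X t \<in> borel_measurable (augmented_filtration M W t)"
    using X by (simp add: strong_solution_def)
  have "AE \<omega> in M. \<forall>t\<in>{0..T}. set_integrable lborel {0..t} (\<lambda>s. b s (X s \<omega>)) \<and>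
        X t \<omega> = x0 + (LINT s:{0..t}|lborel. b s (X s \<omega>)) + R t \<omega>"
    using X by (simp add: strong_solution_def)
  with lip AE_continuous AE_avoids_countable[OF S]
  show "AE \<omega> in M. \<forall>t\<in>{0..T}. set_integrable lborel {0..t} (\<lambda>s. b' s (X s \<omega>)) \<and>
        X t \<omega> = x0 + (LINT s:{0..t}|lborel. b' s (X s \<omega>)) + R t \<omega>"
  proof eventually_elim
    case (elim \<omega>)
    from elim(1) obtain K where K: "K-lipschitz_on {0..T} (\<lambda>t. X t \<omega> - R t \<omega>)" by blast
    have contX: "continuous_on {0..T} (\<lambda>t. X t \<omega>)"
      using continuous_on_add[OF lipschitz_on_continuous_on[OF K] elim(2)] by simp
    have "AE s in lborel. s \<in> {0..T} \<longrightarrow> X s \<omega> \<notin> S"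
      by (rule elim(3)[THEN spec, THEN spec, THEN mp, OF K])
    then have ae: "AE s in lborel. s \<in> {0..T} \<longrightarrow> b s (X s \<omega>) = b' s (X s \<omega>)"
      by eventually_elim (auto simp: eq)
    show ?case
    proof
      fix t assume t: "t \<in> {0..T}"
      have m: "set_borel_measurable lborel {0..t} (\<lambda>s. b s (X s \<omega>))"
        "set_borel_measurable lborel {0..t} (\<lambda>s. b' s (X s \<omega>))"
        using drift_path_measurable[OF b contX t] drift_path_measurable[OF b' contX t] .
      have ae': "AE s in lborel. indicator {0..t} s *\<^sub>R b s (X s \<omega>) = indicator {0..t} s *\<^sub>R b' s (X s \<omega>)"
        using ae by eventually_elim (use t in \<open>auto simp: indicator_def\<close>)
      have "set_integrable lborel {0..t} (\<lambda>s. b' s (X s \<omega>))"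
        using elim(4) t integrable_cong_AE[OF m[unfolded set_borel_measurable_def] ae']
        by (auto simp: set_integrable_def)
      moreover have "(LINT s:{0..t}|lborel. b s (X s \<omega>)) = (LINT s:{0..t}|lborel. b' s (X s \<omega>))"
        using integral_cong_AE[OF m[unfolded set_borel_measurable_def] ae']
        by (simp add: set_lebesgue_integral_def)
      ultimately show "set_integrable lborel {0..t} (\<lambda>s. b' s (X s \<omega>)) \<and>
        X t \<omega> = x0 + (LINT s:{0..t}|lborel. b' s (X s \<omega>)) + R t \<omega>"
        using elim(4) t by auto
    qed
  qed
qed

text \<open>Boundedness on both sides makes every solution of either equation Lipschitz relative to
  \<open>R\<close>. The two solution sets then coincide, which transfers uniqueness as well as
  existence.\<close>

lemma strong_solution_change_bounded_drift:
  assumes "\<forall>t\<in>{0..T}. \<forall>x. \<bar>b t x\<bar> \<le> K" "\<forall>t\<in>{0..T}. \<forall>x. \<bar>b' t x\<bar> \<le> K'"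
    and "drift_measurable T b" "drift_measurable T b'"
    and "countable S" "\<And>t x. t \<in> {0..T} \<Longrightarrow> x \<notin> S \<Longrightarrow> b t x = b' t x"
  shows "strong_solution M T W R x0 b = strong_solution M T W R x0 b'"
proof
  fix X
  have lip: "AE \<omega> in M. \<exists>K. K-lipschitz_on {0..T} (\<lambda>t. X t \<omega> - R t \<omega>)"
    if "strong_solution M T W R x0 b X \<or> strong_solution M T W R x0 b' X"
    using that bounded_drift_lipschitz[OF _ assms(1), of X] bounded_drift_lipschitz[OF _ assms(2), of X]
    by (auto elim!: eventually_mono)
  show "strong_solution M T W R x0 b X = strong_solution M T W R x0 b' X"
    using strong_solution_change_drift[OF _ lip assms(3,4,5)]
      strong_solution_change_drift[OF _ lip assms(4,3,5)] assms(6) by metis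
qed

lemma unique_strong_solution_change_bounded_drift:
  assumes "\<forall>t\<in>{0..T}. \<forall>x. \<bar>b t x\<bar> \<le> K" "\<forall>t\<in>{0..T}. \<forall>x. \<bar>b' t x\<bar> \<le> K'"
    and "drift_measurable T b" "drift_measurable T b'"
    and "countable S" "\<And>t x. t \<in> {0..T} \<Longrightarrow> x \<notin> S \<Longrightarrow> b t x = b' t x"
  shows "unique_strong_solution M T W R x0 b = unique_strong_solution M T W R x0 b'"
proof -
  have "strong_solution M T W R x0 b = strong_solution M T W R x0 b'"
    by (rule strong_solution_change_bounded_drift[OF assms])
  then show ?thesis
    by (simp only: unique_strong_solution_def strong_existence_def strong_uniqueness_def)
qed

section \<open>Constant drifts and the classes of drifts in the theorem\<close>

lemma strong_solution_const_drift:
  "strong_solution M T W R x0 (\<lambda>_ _. \<kappa>) (\<lambda>t \<omega>. x0 + \<kappa> * t + R t \<omega>)"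
proof -
  have "(LINT s:{0..t}|lborel. \<kappa>) = \<kappa> * t" if "0 \<le> t" for t :: real
    using that by (simp add: set_lebesgue_integral_def)
  moreover have "set_integrable lborel {0..t} (\<lambda>s. \<kappa>)" for t :: real
    by (intro borel_integrable_atLeastAtMost' continuous_intros)
  ultimately show ?thesis
    unfolding strong_solution_def
    by (auto intro!: borel_measurable_add riemann_liouville_adapted[OF brownian riemann_liouville])
qed

lemma unique_strong_solution_const_drift:
  "unique_strong_solution M T W R x0 (\<lambda>_ _. \<kappa>)"
  unfolding unique_strong_solution_def strong_existence_def strong_uniqueness_def
proof (intro conjI allI impI)
  show "\<exists>X. strong_solution M T W R x0 (\<lambda>_ _. \<kappa>) X"
    using strong_solution_const_drift by blast
  fix X Y
  assume "strong_solution M T W R x0 (\<lambda>_ _. \<kappa>) X \<and> strong_solution M T W R x0 (\<lambda>_ _. \<kappa>) Y"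
  then have "AE \<omega> in M. \<forall>t\<in>{0..T}. set_integrable lborel {0..t} (\<lambda>s. \<kappa>) \<and>
      X t \<omega> = x0 + (LINT s:{0..t}|lborel. \<kappa>) + R t \<omega>"
    "AE \<omega> in M. \<forall>t\<in>{0..T}. set_integrable lborel {0..t} (\<lambda>s. \<kappa>) \<and>
      Y t \<omega> = x0 + (LINT s:{0..t}|lborel. \<kappa>) + R t \<omega>"
    unfolding strong_solution_def by blast+
  then show "AE \<omega> in M. \<forall>t\<in>{0..T}. X t \<omega> = Y t \<omega>"
    by eventually_elim simp
qed

lemma drift_measurable_const: "drift_measurable T (\<lambda>_ _. \<kappa>)"
  by (simp add: drift_measurable_def)

text \<open>The translate \<open>x0 + R\<close> solves the equation without drift and spends no time
  in \<open>S\<close>, so it does not notice \<open>b\<close>.\<close>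

lemma strong_existence_countable_support:
  assumes b: "drift_measurable T b" and S: "countable S"
    and zero: "\<And>t x. t \<in> {0..T} \<Longrightarrow> x \<notin> S \<Longrightarrow> b t x = 0"
  shows "strong_existence M T W R x0 b"
proof -
  have sol: "strong_solution M T W R x0 (\<lambda>_ _. 0) (\<lambda>t \<omega>. x0 + 0 * t + R t \<omega>)"
    by (rule strong_solution_const_drift)
  from bounded_drift_lipschitz[OF this, of 0]
  have "AE \<omega> in M. \<exists>K. K-lipschitz_on {0..T} (\<lambda>t. (x0 + 0 * t + R t \<omega>) - R t \<omega>)"
    by (auto elim!: eventually_mono)
  from strong_solution_change_drift[OF sol this drift_measurable_const b S] zero
  show ?thesis unfolding strong_existence_def by metis
qed

lemma strong_existence_linear_growth:
  assumes b: "drift_measurable T b"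
    and growth: "\<forall>t\<in>{0..T}. \<forall>x. \<bar>b t x\<bar> \<le> C * (1 + \<bar>x\<bar>)"
    and S: "countable S" and cont: "\<And>t x. t \<in> {0..T} \<Longrightarrow> x \<notin> S \<Longrightarrow> isCont (b t) x"
  shows "strong_existence M T W R x0 b"
proof -
  obtain V where V: "\<And>t. t \<in> {0..T} \<Longrightarrow> V t \<in> borel_measurable (augmented_filtration M W t)"
    and contV: "\<And>\<omega>. continuous_on {0..T} (\<lambda>t. V t \<omega>)"
    and VR: "AE \<omega> in M. \<forall>t\<in>{0..T}. V t \<omega> = R t \<omega>"
    using continuous_version by blast
  define d where "d = (\<lambda>t x. if t \<in> {0..T} then b t x else 0)"
  define r where "r \<omega> = (\<lambda>t. x0 + V t \<omega>)" for \<omega>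
  define X where "X = (\<lambda>t \<omega>. maximal_solution d C (r \<omega>) t)"
  have C: "0 \<le> C" using growth T_mem by (metis abs_ge_zero add_0_right abs_zero mult.right_neutral order_trans)
  have dm: "case_prod d \<in> borel_measurable (borel \<Otimes>\<^sub>M borel)"
    unfolding d_def by (rule drift_measurable_extend[OF b])
  have dg: "\<bar>d t x\<bar> \<le> C * (1 + \<bar>x\<bar>)" for t x using growth C by (simp add: d_def)
  have rc: "continuous_on {0..T} (r \<omega>)" for \<omega>
    unfolding r_def by (intro continuous_on_add continuous_on_const contV)
  have "strong_solution M T W R x0 b X"
    unfolding strong_solution_def
  proof
    show "\<forall>t\<in>{0..T}. X t \<in> borel_measurable (augmented_filtration M W t)"
    proof
      fix t assume t: "t \<in> {0..T}"
      have "(\<lambda>\<omega>. r \<omega> s) \<in> borel_measurable (augmented_filtration M W s)" if "s \<in> {0..T}" for s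
        unfolding r_def using V[OF that] by simp
      then show "X t \<in> borel_measurable (augmented_filtration M W t)"
        unfolding X_def by (rule maximal_solution_adapted[OF dm dg _ rc t])
    qed
    show "AE \<omega> in M. \<forall>t\<in>{0..T}. set_integrable lborel {0..t} (\<lambda>s. b s (X s \<omega>)) \<and>
        X t \<omega> = x0 + (LINT s:{0..t}|lborel. b s (X s \<omega>)) + R t \<omega>"
      using VR AE_avoids_countable[OF S]
    proof eventually_elim
      case (elim \<omega>)
      \<comment> \<open>\<open>K\<close> may depend on \<open>\<omega>\<close>, since the level-set
        result quantifies over all constants inside the almost sure statement.\<close>
      obtain K where K: "K-lipschitz_on {0..T} (\<lambda>t. X t \<omega> - r \<omega> t)"
        unfolding X_def using maximal_solution(2)[OF dm dg rc] T_pos by auto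
      have "dist (X t \<omega> - R t \<omega>) (X s \<omega> - R s \<omega>) = dist (X t \<omega> - r \<omega> t) (X s \<omega> - r \<omega> s)"
        if "t \<in> {0..T}" "s \<in> {0..T}" for t s
        using elim(1) that by (simp add: r_def dist_real_def)
      with K have "K-lipschitz_on {0..T} (\<lambda>t. X t \<omega> - R t \<omega>)"
        unfolding lipschitz_on_def by simp
      from elim(2)[THEN spec, THEN spec, THEN mp, OF this]
      have "AE s in lborel. s \<in> {0..T} \<longrightarrow> X s \<omega> \<notin> S" .
      then have "AE s in lborel. s \<in> {0..T} \<longrightarrow> isCont (d s) (maximal_solution d C (r \<omega>) s)"
        by eventually_elim (auto simp: d_def X_def cont)
      note sol = maximal_solution(3)[OF dm dg rc less_imp_le[OF T_pos] this, folded X_def]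
      show ?case
      proof
        fix t assume t: "t \<in> {0..T}"
        have d: "set_integrable lborel {0..t} (\<lambda>s. d s (X s \<omega>))"
          "X t \<omega> = r \<omega> t + (LINT s:{0..t}|lborel. d s (X s \<omega>))"
          using sol[OF t] by (auto simp: X_def)
        have eq: "indicator {0..t} s *\<^sub>R d s (X s \<omega>) = indicator {0..t} s *\<^sub>R b s (X s \<omega>)" for s
          using t by (simp add: d_def indicator_def)
        show "set_integrable lborel {0..t} (\<lambda>s. b s (X s \<omega>)) \<and>
          X t \<omega> = x0 + (LINT s:{0..t}|lborel. b s (X s \<omega>)) + R t \<omega>"
          using d elim(1) t unfolding set_integrable_def set_lebesgue_integral_def eq by (simp add: r_def)
      qed
    qed
  qed
  then show ?thesis unfolding strong_existence_def by blast
qed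

text \<open>A non-increasing drift never drives two paths apart: the comparison applies with
  \<open>L = 0\<close> in both directions, path by path.\<close>

lemma strong_uniqueness_antimono:
  assumes mono: "\<forall>t\<in>{0..T}. antimono (b t)"
  shows "strong_uniqueness M T W R x0 b"
  unfolding strong_uniqueness_def
proof (intro allI impI)
  fix X Y assume "strong_solution M T W R x0 b X \<and> strong_solution M T W R x0 b Y"
  then have "AE \<omega> in M. \<forall>t\<in>{0..T}. set_integrable lborel {0..t} (\<lambda>s. b s (X s \<omega>)) \<and>
        X t \<omega> = x0 + (LINT s:{0..t}|lborel. b s (X s \<omega>)) + R t \<omega>"
    "AE \<omega> in M. \<forall>t\<in>{0..T}. set_integrable lborel {0..t} (\<lambda>s. b s (Y s \<omega>)) \<and>
        Y t \<omega> = x0 + (LINT s:{0..t}|lborel. b s (Y s \<omega>)) + R t \<omega>"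
    by (auto simp: strong_solution_def)
  then show "AE \<omega> in M. \<forall>t\<in>{0..T}. X t \<omega> = Y t \<omega>"
  proof eventually_elim
    case (elim \<omega>)
    have le: "b s x - b s y \<le> 0 * (x - y)" if "s \<in> {0..T}" "y < x" for s x y
      using mono that by (auto simp: antimono_def)
    have X: "X t \<omega> = (x0 + R t \<omega>) + (LINT s:{0..t}|lborel. b s (X s \<omega>))"
      and Y: "Y t \<omega> = (x0 + R t \<omega>) + (LINT s:{0..t}|lborel. b s (Y s \<omega>))" if "t \<in> {0..T}" for t
      using elim that by auto
    have int: "set_integrable lborel {0..T} (\<lambda>s. b s (X s \<omega>))" "set_integrable lborel {0..T} (\<lambda>s. b s (Y s \<omega>))"
      using elim T_mem by auto
    show ?case
    proof
      fix t assume t: "t \<in> {0..T}"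
      show "X t \<omega> = Y t \<omega>"
      proof (rule antisym)
        show "X t \<omega> \<le> Y t \<omega>"
          by (rule solutions_le[where X = "\<lambda>t. X t \<omega>" and Y = "\<lambda>t. Y t \<omega>" and g = b and h = b and L = 0,
                OF X Y int le _ t]) auto
        show "Y t \<omega> \<le> X t \<omega>"
          by (rule solutions_le[where X = "\<lambda>t. Y t \<omega>" and Y = "\<lambda>t. X t \<omega>" and g = b and h = b and L = 0,
                OF Y X int(2,1) le _ t]) auto
      qed
    qed
  qed
qed

text \<open>For bounded \<open>b\<close> every solution also solves the equation without drift,
  where it is determined by \<open>R\<close>.\<close>

lemma strong_uniqueness_bounded_countable_support:
  assumes "drift_measurable T b" "countable S" "\<forall>t\<in>{0..T}. \<forall>x. \<bar>b t x\<bar> \<le> K"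
    and "\<And>t x. t \<in> {0..T} \<Longrightarrow> x \<notin> S \<Longrightarrow> b t x = 0"
  shows "strong_uniqueness M T W R x0 b"
  using unique_strong_solution_change_bounded_drift[of b K "\<lambda>_ _. 0" 0 S]
    unique_strong_solution_const_drift[of 0] assms drift_measurable_const
  by (simp add: unique_strong_solution_def)

end


theorem theorem1p7:
  fixes M :: "'a measure" and T H x0 :: real
    and W R :: "real \<Rightarrow> 'a \<Rightarrow> real" and b :: "real \<Rightarrow> real \<Rightarrow> real"
  assumes "prob_space M" and "complete_measure M"
    and "0 < T"
    and "standard_brownian_motion M T W"
    and "0 < H" and "H < 1"
    and "riemann_liouville_process M T W H R"
    and "drift_measurable T b"
  shows
    "(\<comment> \<open>(i)\<close>
      \<forall>m a.
        (\<forall>t\<in>{0..T}. piecewise_uniformly_continuous m a (b t)) \<and>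
        (\<exists>C. \<forall>t\<in>{0..T}. \<forall>x. \<bar>b t x\<bar> \<le> C * (1 + \<bar>x\<bar>)) \<longrightarrow>
        strong_existence M T W R x0 b \<and>
        ((\<forall>t\<in>{0..T}. antimono (b t)) \<longrightarrow> strong_uniqueness M T W R x0 b)) \<and>
     (\<comment> \<open>(ii)\<close>
      \<forall>(m::nat) (S :: nat \<Rightarrow> real set) (f :: nat \<Rightarrow> real \<Rightarrow> real) (q :: nat \<Rightarrow> ereal).
        (\<forall>i\<in>{1..m}. countable (S i) \<and> 1 < q i \<and> in_Lq (q i) (f i)) \<and>
        (\<forall>t\<in>{0..T}. \<forall>x. b t x = (\<Sum>i=1..m. f i x * indicator (S i) x)) \<longrightarrow>
        strong_existence M T W R x0 b \<and>
        ((\<forall>i\<in>{1..m}. bounded (range (f i))) \<longrightarrow> strong_uniqueness M T W R x0 b)) \<and>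
     (\<comment> \<open>(iii)\<close>
      \<forall>S :: real set. countable (- S) \<longrightarrow>
        ((\<forall>t\<in>{0..T}. \<forall>x. b t x = indicator S x) \<longrightarrow>
           unique_strong_solution M T W R x0 b) \<and>
        (\<forall>b'. drift_measurable T b' \<and>
           (\<exists>K. \<forall>t\<in>{0..T}. \<forall>x. \<bar>b' t x\<bar> \<le> K) \<and>
           unique_strong_solution M T W R x0 b' \<and>
           (\<forall>t\<in>{0..T}. \<forall>x. b t x = b' t x * indicator S x) \<longrightarrow>
           unique_strong_solution M T W R x0 b))"
proof -
  interpret prob_space M by fact
  interpret riemann_liouville_sde M T H x0 W R
    by unfold_locales (use assms in auto)
  note b = \<open>drift_measurable T b\<close>
  show ?thesis
  proof (intro conjI allI impI)
    fix m a
    assume A: "(\<forall>t\<in>{0..T}. piecewise_uniformly_continuous m a (b t)) \<and>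
      (\<exists>C. \<forall>t\<in>{0..T}. \<forall>x. \<bar>b t x\<bar> \<le> C * (1 + \<bar>x\<bar>))"
    then obtain C where "\<forall>t\<in>{0..T}. \<forall>x. \<bar>b t x\<bar> \<le> C * (1 + \<bar>x\<bar>)" by blast
    then show "strong_existence M T W R x0 b"
    proof (rule strong_existence_linear_growth[OF b])
      show "countable (a ` {1..m})" by (intro countable_finite finite_imageI) simp
    qed (use A in \<open>blast intro: piecewise_uniformly_continuous_isCont\<close>)
    show "strong_uniqueness M T W R x0 b" if "\<forall>t\<in>{0..T}. antimono (b t)"
      using that by (rule strong_uniqueness_antimono)
  next
    fix m :: nat and S :: "nat \<Rightarrow> real set" and f :: "nat \<Rightarrow> real \<Rightarrow> real" and q :: "nat \<Rightarrow> ereal"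
    assume A: "(\<forall>i\<in>{1..m}. countable (S i) \<and> 1 < q i \<and> in_Lq (q i) (f i)) \<and>
      (\<forall>t\<in>{0..T}. \<forall>x. b t x = (\<Sum>i=1..m. f i x * indicator (S i) x))"
    let ?S = "\<Union>i\<in>{1..m}. S i"
    have S: "countable ?S" using A by (intro countable_UN) auto
    have zero: "b t x = 0" if "t \<in> {0..T}" "x \<notin> ?S" for t x
      using A that by (auto intro!: sum.neutral)
    from b S zero show "strong_existence M T W R x0 b"
      by (rule strong_existence_countable_support)
    assume "\<forall>i\<in>{1..m}. bounded (range (f i))"
    then have "\<forall>i\<in>{1..m}. \<exists>K. \<forall>x. \<bar>f i x\<bar> \<le> K"
      unfolding bounded_iff by auto
    then obtain K where K: "\<And>i x. i \<in> {1..m} \<Longrightarrow> \<bar>f i x\<bar> \<le> K i" by metis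
    have "\<bar>b t x\<bar> \<le> (\<Sum>i=1..m. K i)" if "t \<in> {0..T}" for t x
    proof -
      have "\<bar>b t x\<bar> \<le> (\<Sum>i=1..m. \<bar>f i x * indicator (S i) x\<bar>)"
      proof -
        have "b t x = (\<Sum>i=1..m. f i x * indicator (S i) x)" using A that by blast
        then show ?thesis by (simp only: sum_abs)
      qed
      also have "\<dots> \<le> (\<Sum>i=1..m. K i)"
      proof (rule sum_mono)
        fix i assume "i \<in> {1..m}"
        from K[OF this, of x] show "\<bar>f i x * indicator (S i) x\<bar> \<le> K i"
          by (auto simp: indicator_def intro: order_trans[OF abs_ge_zero])
      qed
      finally show ?thesis .
    qed
    then have "\<forall>t\<in>{0..T}. \<forall>x. \<bar>b t x\<bar> \<le> (\<Sum>i=1..m. K i)" by blast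
    from b S this zero show "strong_uniqueness M T W R x0 b"
      by (rule strong_uniqueness_bounded_countable_support)
  next
    fix S :: "real set" assume S: "countable (- S)"
    assume A: "\<forall>t\<in>{0..T}. \<forall>x. b t x = indicator S x"
    \<comment> \<open>The indicator of \<open>S\<close> differs from the constant 1 only on the
      countable set \<open>- S\<close>.\<close>
    have "unique_strong_solution M T W R x0 b = unique_strong_solution M T W R x0 (\<lambda>_ _. 1)"
      by (rule unique_strong_solution_change_bounded_drift[OF _ _ b drift_measurable_const S])
        (use A in \<open>auto simp: indicator_def\<close>)
    then show "unique_strong_solution M T W R x0 b"
      by (simp add: unique_strong_solution_const_drift)
  next
    fix S :: "real set" and b' assume S: "countable (- S)"
    assume A: "drift_measurable T b' \<and>
           (\<exists>K. \<forall>t\<in>{0..T}. \<forall>x. \<bar>b' t x\<bar> \<le> K) \<and>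
           unique_strong_solution M T W R x0 b' \<and>
           (\<forall>t\<in>{0..T}. \<forall>x. b t x = b' t x * indicator S x)"
    then obtain K where K: "\<forall>t\<in>{0..T}. \<forall>x. \<bar>b' t x\<bar> \<le> K" by blast
    have bK: "\<forall>t\<in>{0..T}. \<forall>x. \<bar>b t x\<bar> \<le> K"
    proof (intro ballI allI)
      fix t x assume t: "t \<in> {0..T}"
      then have "\<bar>b t x\<bar> \<le> \<bar>b' t x\<bar>" using A by (simp add: indicator_def)
      also have "\<dots> \<le> K" using K t by blast
      finally show "\<bar>b t x\<bar> \<le> K" .
    qed
    have "unique_strong_solution M T W R x0 b = unique_strong_solution M T W R x0 b'"
      by (rule unique_strong_solution_change_bounded_drift[OF bK K b _ S]) (use A in auto)
    with A show "unique_strong_solution M T W R x0 b" by blast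
  qed
qed

end
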